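(* Let $T$ be a tournament and $\mathbb{K}$ a field of characteristic zero. The age algebra $\mathbb{K}.\mathcal{A}(T)$ is finitely generated (as a $\mathbb{K}$-algebra) if and only if the profile $\varphi_T$ is bounded.
   Context: A tournament is a directed graph $(E,\rho)$, $\rho\subseteq E^2$ irreflexive, such that for distinct $x,y$ exactly one of $(x,y),(y,x)$ is in $\rho$. The age $\mathcal{A}(T)$ is the set of isomorphism types of finite induced subtournaments; $\varphi_T(n)$ is the number of isomorphism types of $n$-vertex induced subtournaments. Age algebra: the $\mathbb{K}$-vector space with basis $\mathcal{A}(T)$, with product $\alpha\beta=\sum_{\gamma}c^{\gamma}_{\alpha\beta}\gamma$, where for $\gamma$ the type of $T_{\restriction Q}$, $c^{\gamma}_{\alpha\beta}$ is the number of $P\subseteq Q$ such that $T_{\restriction P}$ has type $\alpha$ and $T_{\restriction Q\setminus P}$ has type $\beta$ (independent of the choice of $Q$). *)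

theory Defs
  imports "HOL-Library.Poly_Mapping"
begin

definition tournament :: "'a set \<Rightarrow> 'a rel \<Rightarrow> bool" where
  "tournament E \<rho> \<longleftrightarrow> \<rho> \<subseteq> E \<times> E \<and> irrefl \<rho> \<and>
     (\<forall>x\<in>E. \<forall>y\<in>E. x \<noteq> y \<longrightarrow> ((x, y) \<in> \<rho>) \<noteq> ((y, x) \<in> \<rho>))"

definition induced :: "'a rel \<Rightarrow> 'a set \<Rightarrow> 'a rel" where
  "induced \<rho> P = \<rho> \<inter> (P \<times> P)"

definition digraph_isomorphic :: "'a set \<Rightarrow> 'a rel \<Rightarrow> 'b set \<Rightarrow> 'b rel \<Rightarrow> bool" where
  "digraph_isomorphic E \<rho> F \<sigma> \<longleftrightarrow>
     (\<exists>f. bij_betw f E F \<and> (\<forall>x\<in>E. \<forall>y\<in>E. (x, y) \<in> \<rho> \<longleftrightarrow> (f x, f y) \<in> \<sigma>))"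

text \<open>
  An isomorphism type of finite induced substructures of \<open>(E, \<rho>)\<close> is represented by the class of
  all finite vertex sets that induce a substructure of that type.
\<close>

definition iso_type :: "'a set \<Rightarrow> 'a rel \<Rightarrow> 'a set \<Rightarrow> 'a set set" where
  "iso_type E \<rho> P = {P'. P' \<subseteq> E \<and> finite P' \<and>
     digraph_isomorphic P' (induced \<rho> P') P (induced \<rho> P)}"

definition age :: "'a set \<Rightarrow> 'a rel \<Rightarrow> 'a set set set" where
  "age E \<rho> = {iso_type E \<rho> P | P. P \<subseteq> E \<and> finite P}"

definition profile :: "'a set \<Rightarrow> 'a rel \<Rightarrow> nat \<Rightarrow> nat" where
  "profile E \<rho> n = card {iso_type E \<rho> P | P. P \<subseteq> E \<and> finite P \<and> card P = n}"

definition bounded_profile :: "'a set \<Rightarrow> 'a rel \<Rightarrow> bool" where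
  "bounded_profile E \<rho> \<longleftrightarrow> (\<exists>B. \<forall>n. profile E \<rho> n \<le> B)"

text \<open>
  The structure constant \<open>c\<^sup>\<gamma>\<^sub>\<alpha>\<^sub>\<beta>\<close>. The chosen \<open>Q\<close> is immaterial, see \<open>age_coeff_eq\<close> below.
\<close>

definition age_coeff ::
    "'a set \<Rightarrow> 'a rel \<Rightarrow> 'a set set \<Rightarrow> 'a set set \<Rightarrow> 'a set set \<Rightarrow> nat" where
  "age_coeff E \<rho> \<alpha> \<beta> \<gamma> = (let Q = (SOME Q. Q \<in> \<gamma>) in
     card {P. P \<subseteq> Q \<and> iso_type E \<rho> P = \<alpha> \<and> iso_type E \<rho> (Q - P) = \<beta>})"

text \<open>
  The free vector space on the age consists of the finitely supported functions with support
  contained in the age. In the product, \<open>\<gamma>\<close> ranges over a finite set (see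
  \<open>finite_age_coeff_support\<close> below).
\<close>

definition age_space :: "'a set \<Rightarrow> 'a rel \<Rightarrow> ('a set set \<Rightarrow>\<^sub>0 'k::field) set" where
  "age_space E \<rho> = {f. Poly_Mapping.keys f \<subseteq> age E \<rho>}"

definition age_scale :: "'k::field \<Rightarrow> ('a set set \<Rightarrow>\<^sub>0 'k) \<Rightarrow> ('a set set \<Rightarrow>\<^sub>0 'k)" where
  "age_scale c f = Poly_Mapping.map (\<lambda>x. c * x) f"

definition age_one :: "'a set \<Rightarrow> 'a rel \<Rightarrow> ('a set set \<Rightarrow>\<^sub>0 'k::field)" where
  "age_one E \<rho> = Poly_Mapping.single (iso_type E \<rho> {}) 1"

definition age_mult :: "'a set \<Rightarrow> 'a rel \<Rightarrow>
    ('a set set \<Rightarrow>\<^sub>0 'k::field) \<Rightarrow> ('a set set \<Rightarrow>\<^sub>0 'k) \<Rightarrow> ('a set set \<Rightarrow>\<^sub>0 'k)" where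
  "age_mult E \<rho> f g =
     (\<Sum>\<alpha>\<in>Poly_Mapping.keys f. \<Sum>\<beta>\<in>Poly_Mapping.keys g.
        \<Sum>\<gamma> | \<gamma> \<in> age E \<rho> \<and> age_coeff E \<rho> \<alpha> \<beta> \<gamma> \<noteq> 0.
          Poly_Mapping.single \<gamma>
            (Poly_Mapping.lookup f \<alpha> * Poly_Mapping.lookup g \<beta> * of_nat (age_coeff E \<rho> \<alpha> \<beta> \<gamma>)))"

inductive_set age_generated ::
    "'a set \<Rightarrow> 'a rel \<Rightarrow> ('a set set \<Rightarrow>\<^sub>0 'k::field) set \<Rightarrow> ('a set set \<Rightarrow>\<^sub>0 'k) set"
  for E :: "'a set" and \<rho> :: "'a rel" and S :: "('a set set \<Rightarrow>\<^sub>0 'k::field) set" where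
  one: "age_one E \<rho> \<in> age_generated E \<rho> S"
| incl: "f \<in> S \<Longrightarrow> f \<in> age_generated E \<rho> S"
| add: "f \<in> age_generated E \<rho> S \<Longrightarrow> g \<in> age_generated E \<rho> S \<Longrightarrow> f + g \<in> age_generated E \<rho> S"
| scale: "f \<in> age_generated E \<rho> S \<Longrightarrow> age_scale c f \<in> age_generated E \<rho> S"
| mult: "f \<in> age_generated E \<rho> S \<Longrightarrow> g \<in> age_generated E \<rho> S \<Longrightarrow>
    age_mult E \<rho> f g \<in> age_generated E \<rho> S"

definition age_algebra_finitely_generated :: "'k::field itself \<Rightarrow> 'a set \<Rightarrow> 'a rel \<Rightarrow> bool" where
  "age_algebra_finitely_generated _ E \<rho> \<longleftrightarrow>
     (\<exists>S :: ('a set set \<Rightarrow>\<^sub>0 'k) set. finite S \<and> S \<subseteq> age_space E \<rho> \<and>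
        age_generated E \<rho> S = age_space E \<rho>)"


subsection \<open>Well-definedness\<close>

lemma digraph_isomorphic_refl: "digraph_isomorphic E \<rho> E \<rho>"
  unfolding digraph_isomorphic_def by (rule exI[of _ id]) auto

lemma digraph_isomorphic_sym:
  assumes "digraph_isomorphic E \<rho> F \<sigma>" shows "digraph_isomorphic F \<sigma> E \<rho>"
proof -
  obtain f where f: "bij_betw f E F" "\<forall>x\<in>E. \<forall>y\<in>E. (x, y) \<in> \<rho> \<longleftrightarrow> (f x, f y) \<in> \<sigma>"
    using assms unfolding digraph_isomorphic_def by blast
  have "bij_betw (inv_into E f) F E" using f(1) by (rule bij_betw_inv_into)
  moreover have "\<forall>x\<in>F. \<forall>y\<in>F. (x, y) \<in> \<sigma> \<longleftrightarrow> (inv_into E f x, inv_into E f y) \<in> \<rho>"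
    using f(2) bij_betw_inv_into_right[OF f(1)] bij_betw_apply[OF bij_betw_inv_into[OF f(1)]] by simp
  ultimately show ?thesis unfolding digraph_isomorphic_def by blast
qed

lemma digraph_isomorphic_trans:
  assumes "digraph_isomorphic E \<rho> F \<sigma>" "digraph_isomorphic F \<sigma> G \<tau>"
  shows "digraph_isomorphic E \<rho> G \<tau>"
proof -
  obtain f where f: "bij_betw f E F" "\<forall>x\<in>E. \<forall>y\<in>E. (x, y) \<in> \<rho> \<longleftrightarrow> (f x, f y) \<in> \<sigma>"
    using assms(1) unfolding digraph_isomorphic_def by blast
  obtain g where g: "bij_betw g F G" "\<forall>x\<in>F. \<forall>y\<in>F. (x, y) \<in> \<sigma> \<longleftrightarrow> (g x, g y) \<in> \<tau>"
    using assms(2) unfolding digraph_isomorphic_def by blast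
  have "bij_betw (g \<circ> f) E G" using f(1) g(1) by (rule bij_betw_trans)
  moreover have "\<forall>x\<in>E. \<forall>y\<in>E. (x, y) \<in> \<rho> \<longleftrightarrow> ((g \<circ> f) x, (g \<circ> f) y) \<in> \<tau>"
    using f g by (auto simp: bij_betw_apply)
  ultimately show ?thesis unfolding digraph_isomorphic_def by blast
qed

lemma iso_type_self: "P \<subseteq> E \<Longrightarrow> finite P \<Longrightarrow> P \<in> iso_type E \<rho> P"
  unfolding iso_type_def by (auto intro: digraph_isomorphic_refl)

lemma iso_type_eqI:
  "digraph_isomorphic P (induced \<rho> P) Q (induced \<rho> Q) \<Longrightarrow> iso_type E \<rho> P = iso_type E \<rho> Q"
  unfolding iso_type_def by (blast intro: digraph_isomorphic_sym digraph_isomorphic_trans)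

lemma iso_type_eq_iff:
  assumes "P \<subseteq> E" "finite P"
  shows "iso_type E \<rho> P = iso_type E \<rho> Q \<longleftrightarrow>
    digraph_isomorphic P (induced \<rho> P) Q (induced \<rho> Q)"
proof
  assume "iso_type E \<rho> P = iso_type E \<rho> Q"
  then have "P \<in> iso_type E \<rho> Q" using iso_type_self[OF assms, of \<rho>] by simp
  then show "digraph_isomorphic P (induced \<rho> P) Q (induced \<rho> Q)" by (simp add: iso_type_def)
qed (rule iso_type_eqI)

lemma iso_type_mem_iff:
  assumes "P \<subseteq> E" "finite P"
  shows "P \<in> iso_type E \<rho> Q \<longleftrightarrow> iso_type E \<rho> P = iso_type E \<rho> Q"
  unfolding iso_type_eq_iff[OF assms] using assms by (simp add: iso_type_def)

lemma iso_type_card: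
  assumes "iso_type E \<rho> P = iso_type E \<rho> Q" "P \<subseteq> E" "finite P"
  shows "card P = card Q"
  using assms(1) unfolding iso_type_eq_iff[OF assms(2,3)] digraph_isomorphic_def
  by (auto intro: bij_betw_same_card)

lemma iso_type_image:
  assumes "inj_on f Q" "\<forall>x\<in>Q. \<forall>y\<in>Q. (x, y) \<in> \<rho> \<longleftrightarrow> (f x, f y) \<in> \<rho>" "P \<subseteq> Q"
  shows "iso_type E \<rho> (f ` P) = iso_type E \<rho> P"
proof -
  have "bij_betw f P (f ` P)" using inj_on_subset[OF assms(1,3)] by (simp add: bij_betw_def)
  moreover have "\<forall>x\<in>P. \<forall>y\<in>P. (x, y) \<in> induced \<rho> P \<longleftrightarrow> (f x, f y) \<in> induced \<rho> (f ` P)"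
    using assms(2,3) unfolding induced_def by blast
  ultimately have "digraph_isomorphic P (induced \<rho> P) (f ` P) (induced \<rho> (f ` P))"
    unfolding digraph_isomorphic_def by blast
  then show ?thesis using iso_type_eqI by metis
qed

lemma age_count_cong:
  assumes "digraph_isomorphic Q (induced \<rho> Q) R (induced \<rho> R)"
  shows "card {P. P \<subseteq> Q \<and> iso_type E \<rho> P = \<alpha> \<and> iso_type E \<rho> (Q - P) = \<beta>} =
         card {P. P \<subseteq> R \<and> iso_type E \<rho> P = \<alpha> \<and> iso_type E \<rho> (R - P) = \<beta>}"
proof -
  obtain f where bij: "bij_betw f Q R"
    and f: "\<forall>x\<in>Q. \<forall>y\<in>Q. (x, y) \<in> induced \<rho> Q \<longleftrightarrow> (f x, f y) \<in> induced \<rho> R"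
    using assms unfolding digraph_isomorphic_def by blast
  have R: "R = f ` Q" and inj: "inj_on f Q" using bij by (auto simp: bij_betw_def)
  have f': "\<forall>x\<in>Q. \<forall>y\<in>Q. (x, y) \<in> \<rho> \<longleftrightarrow> (f x, f y) \<in> \<rho>"
    using f R by (auto simp: induced_def)
  note im = iso_type_image[OF inj f']
  have dif: "R - f ` P = f ` (Q - P)" if "P \<subseteq> Q" for P
    using that inj R by (auto simp: inj_on_def)
  have "bij_betw (image f) {P. P \<subseteq> Q \<and> iso_type E \<rho> P = \<alpha> \<and> iso_type E \<rho> (Q - P) = \<beta>}
      {P. P \<subseteq> R \<and> iso_type E \<rho> P = \<alpha> \<and> iso_type E \<rho> (R - P) = \<beta>}" (is "bij_betw _ ?A ?B")
  proof (rule bij_betw_imageI)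
    show "inj_on (image f) ?A"
      using inj_on_image_Pow[OF inj] by (rule inj_on_subset) auto
    show "image f ` ?A = ?B"
    proof (intro equalityI subsetI)
      fix X assume "X \<in> image f ` ?A"
      then show "X \<in> ?B" using im dif R by auto
    next
      fix X assume X: "X \<in> ?B"
      then obtain P where P: "P \<subseteq> Q" "X = f ` P" using R by (auto simp: subset_image_iff)
      then have "P \<in> ?A" using X im[of P] im[of "Q - P"] dif[of P] by auto
      then show "X \<in> image f ` ?A" using P by blast
    qed
  qed
  then show ?thesis by (rule bij_betw_same_card)
qed

lemma age_coeff_eq:
  assumes "Q \<subseteq> E" "finite Q"
  shows "age_coeff E \<rho> \<alpha> \<beta> (iso_type E \<rho> Q) =
    card {P. P \<subseteq> Q \<and> iso_type E \<rho> P = \<alpha> \<and> iso_type E \<rho> (Q - P) = \<beta>}"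
proof -
  have "(SOME R. R \<in> iso_type E \<rho> Q) \<in> iso_type E \<rho> Q"
    using iso_type_self[OF assms] by (rule someI)
  then show ?thesis
    unfolding age_coeff_def Let_def by (intro age_count_cong) (simp add: iso_type_def)
qed

lemma finite_iso_types_of_card:
  "finite {iso_type E \<rho> P | P. P \<subseteq> E \<and> finite P \<and> card P = n}" (is "finite ?T")
proof -
  define std where "std \<alpha> = (SOME \<sigma>. \<sigma> \<subseteq> {..<n} \<times> {..<n} \<and>
      (\<exists>P. P \<subseteq> E \<and> finite P \<and> \<alpha> = iso_type E \<rho> P \<and>
        digraph_isomorphic P (induced \<rho> P) {..<n} \<sigma>))" for \<alpha>
  have std: "std \<alpha> \<subseteq> {..<n} \<times> {..<n} \<and>
      (\<exists>P. P \<subseteq> E \<and> finite P \<and> \<alpha> = iso_type E \<rho> P \<and>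
        digraph_isomorphic P (induced \<rho> P) {..<n} (std \<alpha>))" if "\<alpha> \<in> ?T" for \<alpha>
  proof -
    obtain P where P: "P \<subseteq> E" "finite P" "card P = n" "\<alpha> = iso_type E \<rho> P" using \<open>\<alpha> \<in> ?T\<close> by blast
    obtain f where f: "bij_betw f P {..<n}"
      using P by (metis card_lessThan finite_lessThan finite_same_card_bij)
    define \<sigma> where "\<sigma> = {(f x, f y) | x y. (x, y) \<in> induced \<rho> P}"
    have "\<sigma> \<subseteq> {..<n} \<times> {..<n}"
      using f unfolding \<sigma>_def induced_def bij_betw_def by blast
    moreover have "\<forall>x\<in>P. \<forall>y\<in>P. (x, y) \<in> induced \<rho> P \<longleftrightarrow> (f x, f y) \<in> \<sigma>"
      using f unfolding \<sigma>_def induced_def bij_betw_def inj_on_def by blast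
    ultimately have "\<sigma> \<subseteq> {..<n} \<times> {..<n} \<and> (\<exists>P. P \<subseteq> E \<and> finite P \<and> \<alpha> = iso_type E \<rho> P \<and>
        digraph_isomorphic P (induced \<rho> P) {..<n} \<sigma>)"
      using P f unfolding digraph_isomorphic_def by blast
    then show ?thesis unfolding std_def by (rule someI)
  qed
  have "inj_on std ?T"
  proof (rule inj_onI)
    fix \<alpha> \<beta> assume "\<alpha> \<in> ?T" "\<beta> \<in> ?T" and eq: "std \<alpha> = std \<beta>"
    then obtain P Q where "\<alpha> = iso_type E \<rho> P" "\<beta> = iso_type E \<rho> Q"
      "digraph_isomorphic P (induced \<rho> P) {..<n} (std \<alpha>)"
      "digraph_isomorphic Q (induced \<rho> Q) {..<n} (std \<alpha>)"
      using std[of \<alpha>] std[of \<beta>] by auto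
    then show "\<alpha> = \<beta>"
      using digraph_isomorphic_sym digraph_isomorphic_trans iso_type_eqI by metis
  qed
  moreover have "std ` ?T \<subseteq> Pow ({..<n} \<times> {..<n})" using std by blast
  ultimately show ?thesis
    by (meson finite_Pow_iff finite_SigmaI finite_lessThan inj_on_finite)
qed

lemma finite_age_coeff_support: "finite {\<gamma> \<in> age E \<rho>. age_coeff E \<rho> \<alpha> \<beta> \<gamma> \<noteq> 0}" (is "finite ?S")
proof (cases "?S = {}")
  case False
  have key: "\<exists>Q P. Q \<subseteq> E \<and> finite Q \<and> P \<subseteq> Q \<and> \<gamma> = iso_type E \<rho> Q \<and>
      \<alpha> = iso_type E \<rho> P \<and> \<beta> = iso_type E \<rho> (Q - P)" if "\<gamma> \<in> ?S" for \<gamma>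
  proof -
    have "\<gamma> \<in> age E \<rho>" using that by simp
    then obtain Q where Q: "Q \<subseteq> E" "finite Q" "\<gamma> = iso_type E \<rho> Q" by (auto simp: age_def)
    have "card {P. P \<subseteq> Q \<and> iso_type E \<rho> P = \<alpha> \<and> iso_type E \<rho> (Q - P) = \<beta>} \<noteq> 0"
      using that Q(3) age_coeff_eq[OF Q(1,2), of \<rho> \<alpha> \<beta>] by simp
    then have "{P. P \<subseteq> Q \<and> iso_type E \<rho> P = \<alpha> \<and> iso_type E \<rho> (Q - P) = \<beta>} \<noteq> {}"
      by (metis card.empty)
    then obtain P where "P \<subseteq> Q" "iso_type E \<rho> P = \<alpha>" "iso_type E \<rho> (Q - P) = \<beta>" by blast
    then show ?thesis using Q by (intro exI[of _ Q] exI[of _ P]) simp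
  qed
  obtain \<gamma>0 where \<gamma>0: "\<gamma>0 \<in> ?S" using False by (meson all_not_in_conv)
  obtain Q0 P0 where 0: "Q0 \<subseteq> E" "finite Q0" "P0 \<subseteq> Q0" "\<alpha> = iso_type E \<rho> P0"
    "\<beta> = iso_type E \<rho> (Q0 - P0)" using key[OF \<gamma>0] by (elim exE conjE)
  have "?S \<subseteq> {iso_type E \<rho> P | P. P \<subseteq> E \<and> finite P \<and> card P = card Q0}"
  proof
    fix \<gamma> assume \<gamma>: "\<gamma> \<in> ?S"
    obtain Q P where 1: "Q \<subseteq> E" "finite Q" "P \<subseteq> Q" "\<gamma> = iso_type E \<rho> Q"
      "\<alpha> = iso_type E \<rho> P" "\<beta> = iso_type E \<rho> (Q - P)" using key[OF \<gamma>] by (elim exE conjE)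
    have "card P = card P0"
      by (rule iso_type_card[of E \<rho>]) (use 0 1 in \<open>auto intro: finite_subset\<close>)
    moreover have "card (Q - P) = card (Q0 - P0)"
      by (rule iso_type_card[of E \<rho>]) (use 0 1 in auto)
    moreover have "card Q = card P + card (Q - P)"
      using 1(2,3) by (metis card_Diff_subset card_mono finite_subset le_add_diff_inverse)
    moreover have "card Q0 = card P0 + card (Q0 - P0)"
      using 0(2,3) by (metis card_Diff_subset card_mono finite_subset le_add_diff_inverse)
    ultimately have "card Q = card Q0" by simp
    then show "\<gamma> \<in> {iso_type E \<rho> P | P. P \<subseteq> E \<and> finite P \<and> card P = card Q0}" using 1 by blast
  qed
  then show ?thesis by (rule finite_subset) (rule finite_iso_types_of_card)
next
  case True
  then show ?thesis by (simp only: finite.emptyI)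
qed

lemma lookup_age_scale:
  "Poly_Mapping.lookup (age_scale c f) \<alpha> = c * Poly_Mapping.lookup f \<alpha>"
  unfolding age_scale_def by (simp add: Poly_Mapping.map.rep_eq when_def)

lemma lookup_age_mult:
  assumes "Q \<subseteq> E" "finite Q"
  shows "Poly_Mapping.lookup (age_mult E \<rho> f g) (iso_type E \<rho> Q) =
    (\<Sum>P\<in>Pow Q. Poly_Mapping.lookup f (iso_type E \<rho> P) *
               Poly_Mapping.lookup g (iso_type E \<rho> (Q - P)))"
proof -
  let ?f = "Poly_Mapping.lookup f" and ?g = "Poly_Mapping.lookup g"
  let ?F = "Poly_Mapping.keys f" and ?G = "Poly_Mapping.keys g"
  let ?\<gamma> = "iso_type E \<rho> Q"
  have age: "?\<gamma> \<in> age E \<rho>" using assms unfolding age_def by blast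
  have inner: "(\<Sum>\<gamma> | \<gamma> \<in> age E \<rho> \<and> age_coeff E \<rho> \<alpha> \<beta> \<gamma> \<noteq> 0.
       Poly_Mapping.lookup (Poly_Mapping.single \<gamma> (?f \<alpha> * ?g \<beta> * of_nat (age_coeff E \<rho> \<alpha> \<beta> \<gamma>))) ?\<gamma>)
     = (\<Sum>P\<in>Pow Q. if iso_type E \<rho> P = \<alpha> \<and> iso_type E \<rho> (Q - P) = \<beta> then ?f \<alpha> * ?g \<beta> else 0)"
    (is "?L = ?R") for \<alpha> \<beta>
  proof -
    have "?L = (\<Sum>\<gamma> | \<gamma> \<in> age E \<rho> \<and> age_coeff E \<rho> \<alpha> \<beta> \<gamma> \<noteq> 0.
        if ?\<gamma> = \<gamma> then ?f \<alpha> * ?g \<beta> * of_nat (age_coeff E \<rho> \<alpha> \<beta> ?\<gamma>) else 0)"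
      by (intro sum.cong) (auto simp: lookup_single when_def)
    also have "\<dots> = ?f \<alpha> * ?g \<beta> * of_nat (age_coeff E \<rho> \<alpha> \<beta> ?\<gamma>)"
      using finite_age_coeff_support[of E \<rho> \<alpha> \<beta>] age by (subst sum.delta') auto
    also have "\<dots> = ?f \<alpha> * ?g \<beta> *
        of_nat (card {P \<in> Pow Q. iso_type E \<rho> P = \<alpha> \<and> iso_type E \<rho> (Q - P) = \<beta>})"
      by (simp add: age_coeff_eq[OF assms])
    also have "\<dots> = ?R"
      using assms by (simp add: sum.If_cases Int_def mult.commute)
    finally show ?thesis .
  qed
  have "Poly_Mapping.lookup (age_mult E \<rho> f g) ?\<gamma> =
     (\<Sum>\<alpha>\<in>?F. \<Sum>\<beta>\<in>?G. \<Sum>P\<in>Pow Q.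
        if iso_type E \<rho> P = \<alpha> \<and> iso_type E \<rho> (Q - P) = \<beta> then ?f \<alpha> * ?g \<beta> else 0)"
    unfolding age_mult_def by (simp only: lookup_sum inner)
  also have "\<dots> = (\<Sum>P\<in>Pow Q. \<Sum>\<alpha>\<in>?F. \<Sum>\<beta>\<in>?G.
        if iso_type E \<rho> P = \<alpha> \<and> iso_type E \<rho> (Q - P) = \<beta> then ?f \<alpha> * ?g \<beta> else 0)"
    by (simp only: sum.swap[where A = ?G and B = "Pow Q"] sum.swap[where A = ?F and B = "Pow Q"])
  also have "\<dots> = (\<Sum>P\<in>Pow Q. ?f (iso_type E \<rho> P) * ?g (iso_type E \<rho> (Q - P)))"
  proof (intro sum.cong refl)
    fix P
    have "(\<Sum>\<alpha>\<in>?F. \<Sum>\<beta>\<in>?G.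
        if iso_type E \<rho> P = \<alpha> \<and> iso_type E \<rho> (Q - P) = \<beta> then ?f \<alpha> * ?g \<beta> else 0) =
      (\<Sum>\<alpha>\<in>?F. if iso_type E \<rho> P = \<alpha> then
         (\<Sum>\<beta>\<in>?G. if iso_type E \<rho> (Q - P) = \<beta> then ?f \<alpha> * ?g \<beta> else 0) else 0)"
      by (intro sum.cong) auto
    also have "\<dots> = ?f (iso_type E \<rho> P) * ?g (iso_type E \<rho> (Q - P))"
      by (auto simp: sum.delta in_keys_iff)
    finally show "(\<Sum>\<alpha>\<in>?F. \<Sum>\<beta>\<in>?G.
        if iso_type E \<rho> P = \<alpha> \<and> iso_type E \<rho> (Q - P) = \<beta> then ?f \<alpha> * ?g \<beta> else 0) =
      ?f (iso_type E \<rho> P) * ?g (iso_type E \<rho> (Q - P))" .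
  qed
  finally show ?thesis .
qed

lemma age_scale_closed: "f \<in> age_space E \<rho> \<Longrightarrow> age_scale c f \<in> age_space E \<rho>"
  unfolding age_space_def by (auto simp: in_keys_iff lookup_age_scale)

lemma age_one_closed: "age_one E \<rho> \<in> age_space E \<rho>"
  unfolding age_space_def age_one_def age_def by auto

lemma age_add_closed: "f \<in> age_space E \<rho> \<Longrightarrow> g \<in> age_space E \<rho> \<Longrightarrow> f + g \<in> age_space E \<rho>"
  using Poly_Mapping.keys_add[of f g] unfolding age_space_def by blast

lemma age_mult_closed: "age_mult E \<rho> f g \<in> age_space E \<rho>"
proof -
  have "Poly_Mapping.lookup (age_mult E \<rho> f g) \<delta> = 0" if "\<delta> \<notin> age E \<rho>" for \<delta>
    unfolding age_mult_def lookup_sum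
    by (intro sum.neutral ballI) (use that in \<open>auto simp: lookup_single when_def\<close>)
  then show ?thesis unfolding age_space_def by (auto simp: in_keys_iff)
qed

lemma age_space_eqI:
  assumes "f \<in> age_space E \<rho>" "g \<in> age_space E \<rho>"
    and "\<And>Q. Q \<subseteq> E \<Longrightarrow> finite Q \<Longrightarrow>
      Poly_Mapping.lookup f (iso_type E \<rho> Q) = Poly_Mapping.lookup g (iso_type E \<rho> Q)"
  shows "f = g"
proof (rule poly_mapping_eqI)
  fix \<delta>
  show "Poly_Mapping.lookup f \<delta> = Poly_Mapping.lookup g \<delta>"
  proof (cases "\<delta> \<in> age E \<rho>")
    case True
    then show ?thesis using assms(3) unfolding age_def by blast
  next
    case False
    then have "\<delta> \<notin> Poly_Mapping.keys f" "\<delta> \<notin> Poly_Mapping.keys g"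
      using assms(1,2) unfolding age_space_def by blast+
    then show ?thesis by (simp add: in_keys_iff)
  qed
qed

lemma age_mult_commute: "age_mult E \<rho> f g = age_mult E \<rho> g f"
proof (rule age_space_eqI[OF age_mult_closed age_mult_closed])
  fix Q assume Q: "Q \<subseteq> E" "finite Q"
  show "Poly_Mapping.lookup (age_mult E \<rho> f g) (iso_type E \<rho> Q) =
      Poly_Mapping.lookup (age_mult E \<rho> g f) (iso_type E \<rho> Q)"
    unfolding lookup_age_mult[OF Q]
    by (rule sum.reindex_bij_witness[of _ "\<lambda>P. Q - P" "\<lambda>P. Q - P"])
      (auto simp: double_diff mult.commute)
qed

lemma age_mult_one:
  assumes "f \<in> age_space E \<rho>"
  shows "age_mult E \<rho> (age_one E \<rho>) f = f"
proof (rule age_space_eqI[OF age_mult_closed assms])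
  fix Q assume Q: "Q \<subseteq> E" "finite Q"
  have "Poly_Mapping.lookup (age_one E \<rho>) (iso_type E \<rho> P) = (if P = {} then 1 else 0 :: 'b)"
    if "P \<in> Pow Q" for P
  proof -
    have "finite P" "P \<subseteq> E" using that Q by (auto intro: finite_subset)
    then have "P = {}" if "iso_type E \<rho> P = iso_type E \<rho> {}"
      using iso_type_card[OF that] by simp
    then show ?thesis unfolding age_one_def by (auto simp: lookup_single when_def)
  qed
  then have "Poly_Mapping.lookup (age_mult E \<rho> (age_one E \<rho>) f) (iso_type E \<rho> Q) =
      (\<Sum>P\<in>Pow Q. if P = {} then Poly_Mapping.lookup f (iso_type E \<rho> (Q - P)) else 0)"
    unfolding lookup_age_mult[OF Q] by (intro sum.cong) auto
  also have "\<dots> = Poly_Mapping.lookup f (iso_type E \<rho> Q)"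
    using Q by (subst sum.delta) auto
  finally show "Poly_Mapping.lookup (age_mult E \<rho> (age_one E \<rho>) f) (iso_type E \<rho> Q) =
      Poly_Mapping.lookup f (iso_type E \<rho> Q)" .
qed

lemma age_mult_assoc:
  "age_mult E \<rho> (age_mult E \<rho> f g) h = age_mult E \<rho> f (age_mult E \<rho> g h)"
proof (rule age_space_eqI[OF age_mult_closed age_mult_closed])
  fix Q assume Q: "Q \<subseteq> E" "finite Q"
  let ?f = "\<lambda>P. Poly_Mapping.lookup f (iso_type E \<rho> P)"
  let ?g = "\<lambda>P. Poly_Mapping.lookup g (iso_type E \<rho> P)"
  let ?h = "\<lambda>P. Poly_Mapping.lookup h (iso_type E \<rho> P)"
  have fin: "finite P" "P \<subseteq> E" if "P \<subseteq> Q" for P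
    using that Q by (auto intro: finite_subset)
  have "Poly_Mapping.lookup (age_mult E \<rho> (age_mult E \<rho> f g) h) (iso_type E \<rho> Q) =
      (\<Sum>P\<in>Pow Q. \<Sum>R\<in>Pow P. ?f R * ?g (P - R) * ?h (Q - P))"
    unfolding lookup_age_mult[OF Q]
    by (intro sum.cong refl) (auto simp: lookup_age_mult fin sum_distrib_right)
  also have "\<dots> = (\<Sum>(P, R)\<in>Sigma (Pow Q) Pow. ?f R * ?g (P - R) * ?h (Q - P))"
    using Q(2) fin by (subst sum.Sigma) auto
  also have "\<dots> = (\<Sum>(R, S)\<in>Sigma (Pow Q) (\<lambda>R. Pow (Q - R)). ?f R * (?g S * ?h (Q - R - S)))"
  proof (rule sum.reindex_bij_witness[of _ "\<lambda>(R, S). (R \<union> S, R)" "\<lambda>(P, R). (R, P - R)"])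
    fix a assume "a \<in> Sigma (Pow Q) Pow"
    then obtain P R where a: "a = (P, R)" "P \<subseteq> Q" "R \<subseteq> P" by auto
    have "Q - R - (P - R) = Q - P" using a by auto
    then show "(case case a of (P, R) \<Rightarrow> (R, P - R) of
        (R, S) \<Rightarrow> ?f R * (?g S * ?h (Q - R - S))) =
        (case a of (P, R) \<Rightarrow> ?f R * ?g (P - R) * ?h (Q - P))"
      using a by (simp add: mult.assoc)
  qed auto
  also have "\<dots> = (\<Sum>R\<in>Pow Q. \<Sum>S\<in>Pow (Q - R). ?f R * (?g S * ?h (Q - R - S)))"
    using Q(2) by (subst sum.Sigma) auto
  also have "\<dots> = Poly_Mapping.lookup (age_mult E \<rho> f (age_mult E \<rho> g h)) (iso_type E \<rho> Q)"
    unfolding lookup_age_mult[OF Q]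
    by (intro sum.cong refl) (auto simp: lookup_age_mult fin sum_distrib_left)
  finally show "Poly_Mapping.lookup (age_mult E \<rho> (age_mult E \<rho> f g) h) (iso_type E \<rho> Q) =
      Poly_Mapping.lookup (age_mult E \<rho> f (age_mult E \<rho> g h)) (iso_type E \<rho> Q)" .
qed

lemma age_mult_add_left:
  "age_mult E \<rho> (f + g) h = age_mult E \<rho> f h + age_mult E \<rho> g h"
  by (rule age_space_eqI[OF age_mult_closed age_add_closed[OF age_mult_closed age_mult_closed]])
    (simp add: lookup_age_mult lookup_add distrib_right sum.distrib)

lemma age_mult_scale_left:
  "age_mult E \<rho> (age_scale c f) g = age_scale c (age_mult E \<rho> f g)"
  by (rule age_space_eqI[OF age_mult_closed age_scale_closed[OF age_mult_closed]])
    (simp add: lookup_age_mult lookup_age_scale sum_distrib_left mult.assoc)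

end

theory Submission
  imports Defs "HOL-Library.Ramsey" "HOL.Vector_Spaces"
begin

text \<open>
  Let \<open>e\<close> be the basis vector of the one-vertex tournament. If \<open>E\<close> is infinite, multiplication by
  \<open>e\<close> is injective, so when the profile is bounded it is eventually constant and multiplication by
  \<open>e\<close> is eventually onto; the types of small size then generate.

  Conversely, all acyclic tournaments of a given size are isomorphic, so modulo the ideal of \<open>e\<close>
  every generator can be replaced by an element vanishing on the acyclic types. A product of \<open>k\<close>
  such elements is supported on tournaments with \<open>k\<close> disjoint 3-cycles. Hence, in a finitely
  generated age algebra, the types of large size without \<open>m + 1\<close> disjoint 3-cycles are spanned,
  modulo the types with more disjoint 3-cycles, by multiples of \<open>e\<close>, and their number is bounded
  for every \<open>m\<close>. If finitely many vertices meet all 3-cycles, this bounds the profile. Otherwise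
  Ramsey's theorem yields a homogeneous infinite sequence of disjoint 3-cycles, in which
  arbitrarily many types of the same size without two disjoint 3-cycles can be found.
\<close>

section \<open>The age algebra as a graded vector space\<close>

text \<open>If the generators involve only types of size at most d, a product of k of the modified
  generators reaches size at most k * d. A type without m + 1 disjoint 3-cycles is met only by
  products with k at most m, so beyond size m * d nothing but multiples of the vertex reaches it;
  this is what "large" means. The bound is needed for every m because it is used twice. For m = 1 it
  produces a finite set U meeting all 3-cycles: the tournaments cut out of a homogeneous sequence
  are arranged so that one vertex lies on all their 3-cycles. For m = |U| it then covers every type,
  and |U| is not known in advance. The constructed types are told apart by two invariants, the
  number of 3-cycles and the number of vertices that dominate some 3-cycle. Characteristic zero
  enters through division by positive integers, both in expressing the sum of all types of a given
  size by powers of the vertex and in the injectivity of multiplication by it.\<close>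

global_interpretation age_vs: vector_space age_scale
  by standard (auto intro!: poly_mapping_eqI simp: lookup_age_scale lookup_add algebra_simps)

lemma linear_age_mult: "Vector_Spaces.linear age_scale age_scale (age_mult E \<rho> g)"
proof -
  have "age_mult E \<rho> g (f + h) = age_mult E \<rho> g f + age_mult E \<rho> g h"
    "age_mult E \<rho> g (age_scale c f) = age_scale c (age_mult E \<rho> g f)" for f h c
    unfolding age_mult_commute[of E \<rho> g "f + h"] age_mult_commute[of E \<rho> g f]
      age_mult_commute[of E \<rho> g h] age_mult_commute[of E \<rho> g "age_scale c f"]
    by (rule age_mult_add_left age_mult_scale_left)+
  then show ?thesis
    by (simp add: Vector_Spaces.linear_iff age_vs.vector_space_axioms)
qed

text \<open>The vector space \<open>age_vs\<close> is the whole type of finitely supported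
  functions; the age algebra enters only as a subspace of it.\<close>

lemma subspace_age_space: "age_vs.subspace (age_space E \<rho>)"
proof (rule age_vs.subspaceI)
  show "0 \<in> age_space E \<rho>" by (simp add: age_space_def)
qed (auto intro: age_add_closed age_scale_closed)

lemma subspace_age_generated: "age_vs.subspace (age_generated E \<rho> S)"
proof (rule age_vs.subspaceI)
  show "0 \<in> age_generated E \<rho> S"
    using age_generated.scale[OF age_generated.one, of 0] by (metis age_vs.scale_zero_left)
qed (auto intro: age_generated.intros)

text \<open>A type counts as soon as one of its representatives satisfies \<open>D\<close>, so
  invariance of \<open>D\<close> under isomorphism never has to be checked.\<close>

definition types_of_size :: "'a set \<Rightarrow> 'a rel \<Rightarrow> ('a set \<Rightarrow> bool) \<Rightarrow> nat \<Rightarrow> 'a set set set" where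
  "types_of_size E \<rho> D n = {iso_type E \<rho> Q | Q. Q \<subseteq> E \<and> finite Q \<and> D Q \<and> card Q = n}"

lemma types_of_sizeI:
  "Q \<subseteq> E \<Longrightarrow> finite Q \<Longrightarrow> D Q \<Longrightarrow> card Q = n \<Longrightarrow> iso_type E \<rho> Q \<in> types_of_size E \<rho> D n"
  unfolding types_of_size_def by blast

lemma types_of_sizeE:
  assumes "\<gamma> \<in> types_of_size E \<rho> D n"
  obtains Q where "Q \<subseteq> E" "finite Q" "D Q" "card Q = n" "\<gamma> = iso_type E \<rho> Q"
  using assms unfolding types_of_size_def by blast

lemma finite_types_of_size: "finite (types_of_size E \<rho> D n)"
  by (rule finite_subset[OF _ finite_iso_types_of_card[of E \<rho> n]]) (auto simp: types_of_size_def)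

lemma profile_eq_card_types: "profile E \<rho> n = card (types_of_size E \<rho> (\<lambda>_. True) n)"
  by (simp add: profile_def types_of_size_def)

lemma types_of_size_subset_age: "types_of_size E \<rho> D n \<subseteq> age E \<rho>"
  by (auto simp: types_of_size_def age_def)

lemma iso_type_in_types_of_size_iff:
  assumes "Q \<subseteq> E" "finite Q"
  shows "iso_type E \<rho> Q \<in> types_of_size E \<rho> (\<lambda>_. True) n \<longleftrightarrow> card Q = n"
  using assms iso_type_card[of E \<rho> Q] unfolding types_of_size_def by blast

section \<open>Basis vectors and their spans\<close>

abbreviation basis_vec :: "'b \<Rightarrow> ('b \<Rightarrow>\<^sub>0 'k::field)" where
  "basis_vec \<gamma> \<equiv> Poly_Mapping.single \<gamma> 1"

lemma independent_basis_vecs: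
  "age_vs.independent (basis_vec ` T :: ('b set set \<Rightarrow>\<^sub>0 'c::field) set)"
proof -
  have coord: "Poly_Mapping.lookup f \<gamma> = 0" if "f \<in> age_vs.span (basis_vec ` T)" "\<gamma> \<notin> T"
    for T :: "'b set set set" and f :: "'b set set \<Rightarrow>\<^sub>0 'c" and \<gamma>
    using that(1)
  proof (induction rule: age_vs.span_induct_alt)
    case (step c x y)
    then show ?case
      using that(2) by (auto simp: lookup_add lookup_age_scale lookup_single when_def split: if_splits)
  qed simp
  have "basis_vec \<gamma> \<notin> age_vs.span (basis_vec ` T - {basis_vec \<gamma> :: 'b set set \<Rightarrow>\<^sub>0 'c})"
    if "\<gamma> \<in> T" for T :: "'b set set set" and \<gamma>
  proof
    assume "basis_vec \<gamma> \<in> age_vs.span (basis_vec ` T - {basis_vec \<gamma> :: 'b set set \<Rightarrow>\<^sub>0 'c})"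
    moreover have "basis_vec ` T - {basis_vec \<gamma> :: 'b set set \<Rightarrow>\<^sub>0 'c} \<subseteq> basis_vec ` (T - {\<gamma>})" by auto
    ultimately have "basis_vec \<gamma> \<in> age_vs.span (basis_vec ` (T - {\<gamma>}) :: ('b set set \<Rightarrow>\<^sub>0 'c) set)"
      using age_vs.span_mono by blast
    from coord[OF this, of \<gamma>] show False by simp
  qed
  then show ?thesis by (auto simp: age_vs.dependent_def)
qed

lemma card_basis_vecs: "card (basis_vec ` T :: ('b \<Rightarrow>\<^sub>0 'k::field) set) = card T"
proof (rule card_image, rule inj_onI)
  fix \<gamma> \<delta> assume "basis_vec \<gamma> = (basis_vec \<delta> :: 'b \<Rightarrow>\<^sub>0 'k)"
  then have "Poly_Mapping.lookup (basis_vec \<gamma> :: 'b \<Rightarrow>\<^sub>0 'k) \<gamma> = Poly_Mapping.lookup (basis_vec \<delta>) \<gamma>"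
    by simp
  then show "\<gamma> = \<delta>" by (auto simp: lookup_single when_def split: if_splits)
qed

lemma age_element_eq_sum:
  assumes "finite T" "Poly_Mapping.keys f \<subseteq> T"
  shows "f = (\<Sum>\<gamma>\<in>T. age_scale (Poly_Mapping.lookup f \<gamma>) (basis_vec \<gamma>))"
proof (rule poly_mapping_eqI)
  fix \<delta>
  have "Poly_Mapping.lookup (\<Sum>\<gamma>\<in>T. age_scale (Poly_Mapping.lookup f \<gamma>) (basis_vec \<gamma>)) \<delta>
      = (\<Sum>\<gamma>\<in>T. if \<gamma> = \<delta> then Poly_Mapping.lookup f \<gamma> else 0)"
    unfolding lookup_sum lookup_age_scale by (intro sum.cong) (auto simp: lookup_single when_def)
  also have "\<dots> = Poly_Mapping.lookup f \<delta>"
    using assms by (auto simp: sum.delta in_keys_iff)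
  finally show "Poly_Mapping.lookup f \<delta> =
      Poly_Mapping.lookup (\<Sum>\<gamma>\<in>T. age_scale (Poly_Mapping.lookup f \<gamma>) (basis_vec \<gamma>)) \<delta>" by simp
qed

lemma in_span_basis_vecs:
  assumes "Poly_Mapping.keys f \<subseteq> T"
  shows "f \<in> age_vs.span (basis_vec ` T)"
proof -
  have "f = (\<Sum>\<gamma>\<in>Poly_Mapping.keys f. age_scale (Poly_Mapping.lookup f \<gamma>) (basis_vec \<gamma>))"
    by (rule age_element_eq_sum) auto
  also have "\<dots> \<in> age_vs.span (basis_vec ` T)"
    using assms by (intro age_vs.span_sum age_vs.span_scale age_vs.span_base) auto
  finally show ?thesis .
qed

lemma keys_in_span_basis_vecs:
  assumes "f \<in> age_vs.span (basis_vec ` T)"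
  shows "Poly_Mapping.keys f \<subseteq> T"
  using assms
proof (induction rule: age_vs.span_induct_alt)
  case (step c x y)
  then show ?case by (auto simp: in_keys_iff lookup_add lookup_age_scale lookup_single when_def
      split: if_splits)
qed simp

section \<open>Multiplication by the vertex\<close>

text \<open>In characteristic zero this is the divided power e^n / n! of the vertex
  \<open>e\<close>, as \<open>all_types_Suc\<close> and \<open>age_one_eq_all_types\<close> show
  together.\<close>

definition all_types :: "'a set \<Rightarrow> 'a rel \<Rightarrow> nat \<Rightarrow> ('a set set \<Rightarrow>\<^sub>0 'k::field)" where
  "all_types E \<rho> n = (\<Sum>\<gamma>\<in>types_of_size E \<rho> (\<lambda>_. True) n. basis_vec \<gamma>)"

lemma lookup_all_types:
  assumes "Q \<subseteq> E" "finite Q"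
  shows "Poly_Mapping.lookup (all_types E \<rho> n) (iso_type E \<rho> Q) = (if card Q = n then 1 else 0)"
  unfolding all_types_def lookup_sum
  using iso_type_in_types_of_size_iff[OF assms, of \<rho> n] finite_types_of_size[of E \<rho> "\<lambda>_. True" n]
  by (auto simp: lookup_single when_def sum.delta)

text \<open>For a tournament with nonempty \<open>E\<close> this is the basis vector of the only
  one-vertex type. The form as a sum also gives sense to it for empty \<open>E\<close>, where it is
  0, and for digraphs with several one-vertex types.\<close>

definition age_vertex :: "'a set \<Rightarrow> 'a rel \<Rightarrow> ('a set set \<Rightarrow>\<^sub>0 'k::field)" where
  "age_vertex E \<rho> = all_types E \<rho> 1"

lemma all_types_closed: "all_types E \<rho> n \<in> age_space E \<rho>"
  unfolding all_types_def
  using types_of_size_subset_age[of E \<rho> "\<lambda>_. True" n]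
  by (intro age_vs.subspace_sum[OF subspace_age_space]) (auto simp: age_space_def)

text \<open>Only one-point subsets contribute to the product formula. Multiplication by the vertex
  thus sums over the deletions of a point, which is the action of the inclusion matrix of n-sets in
  (n + 1)-sets.\<close>

lemma lookup_mult_vertex:
  assumes "Q \<subseteq> E" "finite Q"
  shows "Poly_Mapping.lookup (age_mult E \<rho> (age_vertex E \<rho>) f) (iso_type E \<rho> Q) =
    (\<Sum>x\<in>Q. Poly_Mapping.lookup f (iso_type E \<rho> (Q - {x})))"
proof -
  let ?f = "\<lambda>P. Poly_Mapping.lookup f (iso_type E \<rho> P)"
  have "Poly_Mapping.lookup (age_mult E \<rho> (age_vertex E \<rho>) f) (iso_type E \<rho> Q) =
      (\<Sum>P\<in>Pow Q. if card P = 1 then ?f (Q - P) else 0)"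
    unfolding lookup_age_mult[OF assms]
  proof (intro sum.cong refl)
    fix P assume "P \<in> Pow Q"
    then have "P \<subseteq> E" "finite P" using assms by (auto intro: finite_subset)
    then show "Poly_Mapping.lookup (age_vertex E \<rho>) (iso_type E \<rho> P) * ?f (Q - P) =
        (if card P = 1 then ?f (Q - P) else 0)"
      by (simp add: age_vertex_def lookup_all_types)
  qed
  also have "\<dots> = (\<Sum>P\<in>(\<lambda>x. {x}) ` Q. ?f (Q - P))"
    using assms by (intro sum.mono_neutral_cong_right) (auto simp: card_1_singleton_iff)
  also have "\<dots> = (\<Sum>x\<in>Q. ?f (Q - {x}))"
    by (subst sum.reindex) auto
  finally show ?thesis .
qed

text \<open>Each of the n + 1 deletions from an (n + 1)-set leaves an n-set, so the product has the
  constant coefficient n + 1 on sets of that size and 0 elsewhere.\<close>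

lemma all_types_Suc:
  "all_types E \<rho> (Suc n) =
    age_scale (1 / of_nat (Suc n)) (age_mult E \<rho> (age_vertex E \<rho>)
      (all_types E \<rho> n) :: 'a set set \<Rightarrow>\<^sub>0 'k::field_char_0)"
proof (rule age_space_eqI[OF all_types_closed age_scale_closed[OF age_mult_closed]])
  fix Q assume Q: "Q \<subseteq> E" "finite Q"
  have "(\<Sum>x\<in>Q. Poly_Mapping.lookup (all_types E \<rho> n) (iso_type E \<rho> (Q - {x}))) =
      (\<Sum>x\<in>Q. if card Q = Suc n then 1 else 0 :: 'k)"
  proof (intro sum.cong refl)
    fix x assume x: "x \<in> Q"
    have "Q - {x} \<subseteq> E" "finite (Q - {x})" using Q by auto
    then show "Poly_Mapping.lookup (all_types E \<rho> n) (iso_type E \<rho> (Q - {x})) =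
        (if card Q = Suc n then 1 else 0 :: 'k)"
      using x card.remove[OF Q(2) x] by (simp add: lookup_all_types)
  qed
  then show "Poly_Mapping.lookup (all_types E \<rho> (Suc n)) (iso_type E \<rho> Q) =
      Poly_Mapping.lookup (age_scale (1 / of_nat (Suc n)) (age_mult E \<rho> (age_vertex E \<rho>)
      (all_types E \<rho> n) :: 'a set set \<Rightarrow>\<^sub>0 'k)) (iso_type E \<rho> Q)"
    using Q by (simp add: lookup_all_types lookup_age_scale lookup_mult_vertex del: of_nat_Suc)
qed

text \<open>Double counting: an i-set arises by deleting a point from exactly
  \<open>card R - i\<close> sets of size \<open>Suc i\<close>, one for each point of
  \<open>R\<close> outside it.\<close>

lemma sum_subsets_remove:
  fixes \<psi> :: "'b set \<Rightarrow> 'c::comm_semiring_1"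
  assumes "finite R" "i \<le> card R"
  shows "(\<Sum>Z | Z \<subseteq> R \<and> card Z = Suc i. \<Sum>z\<in>Z. \<psi> (Z - {z})) =
    of_nat (card R - i) * (\<Sum>Z | Z \<subseteq> R \<and> card Z = i. \<psi> Z)"
proof -
  have fin: "finite Z" if "Z \<subseteq> R" for Z using that assms by (auto intro: finite_subset)
  have finS: "finite {Z. Z \<subseteq> R \<and> card Z = j}" for j
    using assms by (auto intro: finite_subset[of _ "Pow R"])
  have "(\<Sum>Z | Z \<subseteq> R \<and> card Z = Suc i. \<Sum>z\<in>Z. \<psi> (Z - {z})) =
      (\<Sum>(Z, z)\<in>Sigma {Z. Z \<subseteq> R \<and> card Z = Suc i} (\<lambda>Z. Z). \<psi> (Z - {z}))"
    using finS fin by (subst sum.Sigma) auto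
  also have "\<dots> = (\<Sum>(Z, z)\<in>Sigma {Z. Z \<subseteq> R \<and> card Z = i} (\<lambda>Z. R - Z). \<psi> Z)"
  proof (rule sum.reindex_bij_witness[of _ "\<lambda>(Z, z). (insert z Z, z)" "\<lambda>(Z, z). (Z - {z}, z)"])
    fix a assume "a \<in> Sigma {Z. Z \<subseteq> R \<and> card Z = Suc i} (\<lambda>Z. Z)"
    then obtain Z z where a: "a = (Z, z)" "Z \<subseteq> R" "card Z = Suc i" "z \<in> Z" by blast
    then show "(case case a of (Z, z) \<Rightarrow> (Z - {z}, z) of (Z, z) \<Rightarrow> (insert z Z, z)) = a"
      "(case a of (Z, z) \<Rightarrow> (Z - {z}, z)) \<in> Sigma {Z. Z \<subseteq> R \<and> card Z = i} (\<lambda>Z. R - Z)"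
      "(case case a of (Z, z) \<Rightarrow> (Z - {z}, z) of (Z, z) \<Rightarrow> \<psi> Z) = (case a of (Z, z) \<Rightarrow> \<psi> (Z - {z}))"
      using fin[OF a(2)] by (auto simp: insert_absorb)
  next
    fix b assume "b \<in> Sigma {Z. Z \<subseteq> R \<and> card Z = i} (\<lambda>Z. R - Z)"
    then obtain Z z where b: "b = (Z, z)" "Z \<subseteq> R" "card Z = i" "z \<in> R" "z \<notin> Z" by blast
    then show "(case case b of (Z, z) \<Rightarrow> (insert z Z, z) of (Z, z) \<Rightarrow> (Z - {z}, z)) = b"
      "(case b of (Z, z) \<Rightarrow> (insert z Z, z)) \<in> Sigma {Z. Z \<subseteq> R \<and> card Z = Suc i} (\<lambda>Z. Z)"
      using fin[OF b(2)] by auto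
  qed
  also have "\<dots> = (\<Sum>Z | Z \<subseteq> R \<and> card Z = i. \<Sum>z\<in>R - Z. \<psi> Z)"
    using finS assms by (subst sum.Sigma) auto
  also have "\<dots> = (\<Sum>Z | Z \<subseteq> R \<and> card Z = i. of_nat (card R - i) * \<psi> Z)"
    using fin by (intro sum.cong) (auto simp: card_Diff_subset)
  finally show ?thesis by (simp add: sum_distrib_left)
qed

text \<open>
  The inclusion matrix of \<open>n\<close>-sets in \<open>(n + 1)\<close>-sets has full rank (Gottlieb, Kantor). The sums
  \<open>s i\<close> of \<open>\<phi>\<close> over the \<open>n\<close>-sets meeting \<open>R\<close> in \<open>i\<close> points satisfy a two-term recurrence.
\<close>
lemma vanishing_of_vanishing_removal_sums:
  fixes \<phi> :: "'a set \<Rightarrow> 'k::field_char_0"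
  assumes fin: "finite P" "finite R" and disj: "P \<inter> R = {}"
    and card: "card P = n" "card R = Suc n"
    and zero: "\<And>Q. Q \<subseteq> P \<union> R \<Longrightarrow> card Q = Suc n \<Longrightarrow> (\<Sum>x\<in>Q. \<phi> (Q - {x})) = 0"
  shows "\<phi> P = 0"
proof -
  define sub where "sub S j = {Z. Z \<subseteq> S \<and> card Z = j}" for S :: "'a set" and j
  define s where "s i = (\<Sum>X\<in>sub P (n - i). \<Sum>Z\<in>sub R i. \<phi> (X \<union> Z))" for i
  \<comment> \<open>The point removed from \<open>X \<union> Z\<close> lies in \<open>P\<close> or
    in \<open>R\<close>. Sorting by this is what links \<open>s (Suc i)\<close> to
    \<open>s i\<close>.\<close>
  have split: "(\<Sum>x\<in>X. \<phi> (X - {x} \<union> Z)) + (\<Sum>z\<in>Z. \<phi> (X \<union> (Z - {z}))) = 0"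
    if X: "X \<in> sub P (n - i)" and Z: "Z \<in> sub R (Suc i)" and i: "i \<le> n" for X Z i
  proof -
    have sub: "X \<subseteq> P" "Z \<subseteq> R" and finXZ: "finite X" "finite Z" and dXZ: "X \<inter> Z = {}"
      using X Z fin disj by (auto simp: sub_def intro: finite_subset)
    have "card (X \<union> Z) = Suc n"
      using X Z i finXZ dXZ by (simp add: sub_def card_Un_disjoint)
    then have "0 = (\<Sum>x\<in>X \<union> Z. \<phi> (X \<union> Z - {x}))" using zero[of "X \<union> Z"] sub by auto
    also have "\<dots> = (\<Sum>x\<in>X. \<phi> (X \<union> Z - {x})) + (\<Sum>x\<in>Z. \<phi> (X \<union> Z - {x}))"
      using finXZ dXZ by (rule sum.union_disjoint)
    also have "(\<Sum>x\<in>X. \<phi> (X \<union> Z - {x})) = (\<Sum>x\<in>X. \<phi> (X - {x} \<union> Z))"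
      using dXZ by (intro sum.cong arg_cong[of _ _ \<phi>]) auto
    also have "(\<Sum>x\<in>Z. \<phi> (X \<union> Z - {x})) = (\<Sum>x\<in>Z. \<phi> (X \<union> (Z - {x})))"
      using dXZ by (intro sum.cong arg_cong[of _ _ \<phi>]) auto
    finally show ?thesis by simp
  qed
  have eq: "(\<Sum>X\<in>sub P (n - i). \<Sum>Z\<in>sub R (Suc i). \<Sum>x\<in>X. \<phi> (X - {x} \<union> Z)) +
      of_nat (Suc n - i) * s i = 0" if i: "i \<le> n" for i
  proof -
    have "(\<Sum>X\<in>sub P (n - i). \<Sum>Z\<in>sub R (Suc i). \<Sum>z\<in>Z. \<phi> (X \<union> (Z - {z}))) =
        of_nat (Suc n - i) * s i"
      using sum_subsets_remove[OF fin(2), of i] i card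
      unfolding s_def sub_def sum_distrib_left[of _ _ "{Z. Z \<subseteq> P \<and> card Z = n - i}"]
      by (intro sum.cong refl) (simp del: of_nat_diff)
    moreover have "(\<Sum>X\<in>sub P (n - i). \<Sum>Z\<in>sub R (Suc i).
        (\<Sum>x\<in>X. \<phi> (X - {x} \<union> Z)) + (\<Sum>z\<in>Z. \<phi> (X \<union> (Z - {z})))) = 0"
      using split i by (intro sum.neutral ballI) auto
    ultimately show ?thesis by (simp only: sum.distrib)
  qed
  have step: "of_nat (Suc i) * s (Suc i) + of_nat (Suc n - i) * s i = 0" if i: "i < n" for i
  proof -
    have "Suc (n - Suc i) = n - i" "card P - (n - Suc i) = Suc i" using i card by auto
    then have "(\<Sum>X\<in>sub P (n - i). \<Sum>x\<in>X. \<phi> (X - {x} \<union> Z)) =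
        of_nat (Suc i) * (\<Sum>X\<in>sub P (n - Suc i). \<phi> (X \<union> Z))" for Z
      using sum_subsets_remove[OF fin(1), of "n - Suc i" "\<lambda>X. \<phi> (X \<union> Z)"] card
      by (simp add: sub_def del: of_nat_Suc)
    then have "(\<Sum>X\<in>sub P (n - i). \<Sum>Z\<in>sub R (Suc i). \<Sum>x\<in>X. \<phi> (X - {x} \<union> Z)) =
        of_nat (Suc i) * s (Suc i)"
      unfolding s_def sum.swap[of _ "sub R (Suc i)" "sub P _"]
      by (simp add: sum_distrib_left del: of_nat_Suc)
    then show ?thesis using eq[of i] i by simp
  qed
  \<comment> \<open>For \<open>i = n\<close> the set \<open>X\<close> is empty and nothing can be
    removed from it, so the relation collapses to \<open>s n = 0\<close>. Since \<open>R\<close> has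
    one point more than \<open>P\<close>, the factor \<open>Suc n - i\<close> never vanishes, and
    zero propagates down to \<open>s 0\<close>, which is \<open>\<phi> P\<close>.\<close>
  have "s n = 0"
  proof -
    have "sub P 0 = {{}}" using fin by (auto simp: sub_def card_eq_0_iff intro: finite_subset)
    then show ?thesis using eq[of n] by simp
  qed
  then have "s (n - j) = 0" if "j \<le> n" for j
    using that
  proof (induction j)
    case (Suc j)
    have "Suc (n - Suc j) = n - j" using Suc.prems by simp
    then have "of_nat (Suc n - (n - Suc j)) * s (n - Suc j) = 0"
      using step[of "n - Suc j"] Suc by simp
    moreover have "Suc n - (n - Suc j) \<noteq> 0" using Suc.prems by simp
    ultimately show ?case by (simp del: of_nat_Suc)
  qed simp
  from this[of n] have "s 0 = 0" by simp
  moreover have "sub P n = {P}"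
    using card card_subset_eq[OF fin(1)] by (auto simp only: sub_def)
  moreover have "sub R 0 = {{}}" using fin by (auto simp: sub_def card_eq_0_iff intro: finite_subset)
  ultimately show ?thesis by (simp add: s_def)
qed

text \<open>An infinite \<open>E\<close> always has room for the auxiliary set \<open>R\<close> of
  \<open>card P + 1\<close> points outside \<open>P\<close>.\<close>

lemma mult_vertex_eq_0D:
  fixes f :: "'a set set \<Rightarrow>\<^sub>0 'k::field_char_0"
  assumes "infinite E" "f \<in> age_space E \<rho>" "age_mult E \<rho> (age_vertex E \<rho>) f = 0"
  shows "f = 0"
proof (rule age_space_eqI[OF assms(2)])
  show "0 \<in> age_space E \<rho>" by (simp add: age_space_def)
  fix P assume P: "P \<subseteq> E" "finite P"
  obtain R where R: "finite R" "card R = Suc (card P)" "R \<subseteq> E - P"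
    using infinite_arbitrarily_large[of "E - P" "Suc (card P)"] assms(1) P by auto
  have "Poly_Mapping.lookup f (iso_type E \<rho> P) = 0"
  proof (rule vanishing_of_vanishing_removal_sums[OF P(2) R(1) _ refl R(2)])
    show "P \<inter> R = {}" using R by auto
    fix Q assume "Q \<subseteq> P \<union> R"
    then have "Q \<subseteq> E" "finite Q" using P R by (auto intro: finite_subset)
    from lookup_mult_vertex[OF this, of \<rho> f] assms(3)
    show "(\<Sum>x\<in>Q. Poly_Mapping.lookup f (iso_type E \<rho> (Q - {x}))) = 0" by simp
  qed
  then show "Poly_Mapping.lookup f (iso_type E \<rho> P) = Poly_Mapping.lookup 0 (iso_type E \<rho> P)" by simp
qed

section \<open>Bounded profile implies finite generation\<close>

lemma mult_vertex_basis_vec_in_span: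
  assumes "\<delta> \<in> types_of_size E \<rho> (\<lambda>_. True) n"
  shows "age_mult E \<rho> (age_vertex E \<rho>) (basis_vec \<delta> :: 'a set set \<Rightarrow>\<^sub>0 'k::field) \<in>
    age_vs.span (basis_vec ` types_of_size E \<rho> (\<lambda>_. True) (Suc n))"
proof (rule in_span_basis_vecs, rule subsetI)
  let ?f = "age_mult E \<rho> (age_vertex E \<rho>) (basis_vec \<delta> :: 'a set set \<Rightarrow>\<^sub>0 'k)"
  fix \<gamma> assume \<gamma>: "\<gamma> \<in> Poly_Mapping.keys ?f"
  then have "\<gamma> \<in> age E \<rho>" using age_mult_closed[of E \<rho>] by (auto simp: age_space_def)
  then obtain Q where Q: "Q \<subseteq> E" "finite Q" "\<gamma> = iso_type E \<rho> Q" by (auto simp: age_def)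
  have "(\<Sum>x\<in>Q. Poly_Mapping.lookup (basis_vec \<delta> :: 'a set set \<Rightarrow>\<^sub>0 'k) (iso_type E \<rho> (Q - {x}))) \<noteq> 0"
    using \<gamma> unfolding Q(3) in_keys_iff lookup_mult_vertex[OF Q(1,2)] .
  then obtain x where x: "x \<in> Q" "iso_type E \<rho> (Q - {x}) = \<delta>"
    by (elim sum.not_neutral_contains_not_neutral) (auto simp: lookup_single when_def split: if_splits)
  have "Q - {x} \<subseteq> E" "finite (Q - {x})" using Q by auto
  from iso_type_in_types_of_size_iff[OF this, of \<rho> n] have "card (Q - {x}) = n"
    using assms unfolding x(2) by blast
  then have "card Q = Suc n" using card.remove[OF Q(2) x(1)] by simp
  then show "\<gamma> \<in> types_of_size E \<rho> (\<lambda>_. True) (Suc n)"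
    unfolding Q(3) iso_type_in_types_of_size_iff[OF Q(1,2)] .
qed

lemma finite_basis_vecs: "finite (basis_vec ` types_of_size E \<rho> D n)"
  by (intro finite_imageI finite_types_of_size)

text \<open>The dimension count behind the next two lemmas: as many independent vectors as there are
  types of size n, all inside a space whose dimension is the number of types of size n + 1.\<close>

lemma mult_vertex_image:
  fixes E :: "'a set" and \<rho> :: "'a rel" and n :: nat
  assumes "infinite E"
  defines "V \<equiv> (\<lambda>f. age_mult E \<rho> (age_vertex E \<rho>) f) ` basis_vec ` types_of_size E \<rho> (\<lambda>_. True) n
    :: ('a set set \<Rightarrow>\<^sub>0 'k::field_char_0) set"
  shows "age_vs.independent V" "card V = profile E \<rho> n"
    "V \<subseteq> age_vs.span (basis_vec ` types_of_size E \<rho> (\<lambda>_. True) (Suc n))"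
proof -
  let ?T = "types_of_size E \<rho> (\<lambda>_. True)"
  let ?m = "\<lambda>f :: 'a set set \<Rightarrow>\<^sub>0 'k. age_mult E \<rho> (age_vertex E \<rho>) f"
  interpret e: Vector_Spaces.linear age_scale age_scale ?m by (rule linear_age_mult)
  have inj: "inj_on ?m (age_vs.span (basis_vec ` ?T n))"
  proof (rule inj_onI)
    fix u w assume "u \<in> age_vs.span (basis_vec ` ?T n)" "w \<in> age_vs.span (basis_vec ` ?T n)"
      and eq: "?m u = ?m w"
    then have "u - w \<in> age_vs.span (basis_vec ` ?T n)" by (simp add: age_vs.span_diff)
    from keys_in_span_basis_vecs[OF this] have "u - w \<in> age_space E \<rho>"
      using types_of_size_subset_age[of E \<rho> "\<lambda>_. True" n] by (auto simp only: age_space_def)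
    moreover have "?m (u - w) = 0" using eq by (simp add: e.diff)
    ultimately have "u - w = 0" using mult_vertex_eq_0D[OF assms(1)] by blast
    then show "u = w" by simp
  qed
  show "age_vs.independent V"
    unfolding V_def by (rule e.independent_injective_image[OF independent_basis_vecs inj])
  show "card V = profile E \<rho> n"
    unfolding V_def card_image[OF inj_on_subset[OF inj age_vs.span_superset]]
    by (simp only: card_basis_vecs profile_eq_card_types)
  show "V \<subseteq> age_vs.span (basis_vec ` ?T (Suc n))"
    unfolding V_def by (intro image_subsetI) (auto intro: mult_vertex_basis_vec_in_span)
qed

lemma profile_mono:
  assumes "infinite E"
  shows "profile E \<rho> n \<le> profile E \<rho> (Suc n)"
  \<comment> \<open>The profile involves no field, so one of characteristic zero has to be chosen;
    \<open>rat\<close> serves.\<close>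
  using age_vs.independent_span_bound[OF finite_basis_vecs mult_vertex_image(1,3)[OF assms, where 'k = rat]]
  by (simp add: mult_vertex_image(2)[OF assms] card_basis_vecs profile_eq_card_types)

text \<open>An independent family as large as the dimension spans: a basis vector outside the span
  could be added to it and would exceed the dimension.\<close>

lemma basis_vec_in_span_mult_vertex:
  assumes "infinite E" "profile E \<rho> n = profile E \<rho> (Suc n)"
    and "\<gamma> \<in> types_of_size E \<rho> (\<lambda>_. True) (Suc n)"
  shows "(basis_vec \<gamma> :: 'a set set \<Rightarrow>\<^sub>0 'k::field_char_0) \<in> age_vs.span
    ((\<lambda>f. age_mult E \<rho> (age_vertex E \<rho>) f) ` basis_vec ` types_of_size E \<rho> (\<lambda>_. True) n)"
    (is "_ \<in> age_vs.span ?V")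
proof (rule ccontr)
  assume out: "(basis_vec \<gamma> :: 'a set set \<Rightarrow>\<^sub>0 'k) \<notin> age_vs.span ?V"
  let ?W = "insert (basis_vec \<gamma> :: 'a set set \<Rightarrow>\<^sub>0 'k) ?V"
  have "?W \<subseteq> age_vs.span (basis_vec ` types_of_size E \<rho> (\<lambda>_. True) (Suc n))"
    using assms(3) by (intro insert_subsetI mult_vertex_image(3)[OF assms(1)] age_vs.span_base imageI)
  moreover have "age_vs.independent ?W"
    using out mult_vertex_image(1)[OF assms(1)] by (rule age_vs.independent_insertI)
  ultimately have "card ?W \<le> profile E \<rho> (Suc n)"
    using age_vs.independent_span_bound[OF finite_basis_vecs, of ?W E \<rho> "\<lambda>_. True" "Suc n"]
    by (simp add: card_basis_vecs profile_eq_card_types)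
  moreover have "card ?W = Suc (card ?V)"
    using out age_vs.span_base[of "basis_vec \<gamma>" ?V]
    by (intro card_insert_disjoint finite_imageI finite_types_of_size) auto
  ultimately show False using mult_vertex_image(2)[OF assms(1), of \<rho> n, where 'k = 'k] assms(2) by simp
qed

lemma mono_bounded_eventually_constant:
  fixes t :: "nat \<Rightarrow> nat"
  assumes "\<And>n. t n \<le> t (Suc n)" "\<And>n. t n \<le> B"
  obtains N where "\<And>n. N \<le> n \<Longrightarrow> t n = t N"
proof -
  have "finite (range t)" using assms(2) by (auto intro: finite_subset[of _ "{..B}"])
  then have "Max (range t) \<in> range t" by (intro Max_in) auto
  then obtain N where N: "t N = Max (range t)" by auto
  have "t n = t N" if "N \<le> n" for n
  proof (rule order_antisym)
    show "t n \<le> t N" unfolding N using \<open>finite (range t)\<close> by simp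
  qed (use lift_Suc_mono_le[of t] assms(1) that in blast)
  then show ?thesis using that by blast
qed

lemma finitely_generated_if_bounded_profile:
  assumes "bounded_profile E \<rho>"
  shows "age_algebra_finitely_generated TYPE('k::field_char_0) E \<rho>"
proof -
  let ?T = "types_of_size E \<rho> (\<lambda>_. True)"
  let ?V = "\<lambda>n. (\<lambda>f. age_mult E \<rho> (age_vertex E \<rho>) f) ` basis_vec ` ?T n :: ('a set set \<Rightarrow>\<^sub>0 'k) set"
  obtain N where N: "\<And>n \<gamma>. N \<le> n \<Longrightarrow> \<gamma> \<in> ?T (Suc n) \<Longrightarrow> basis_vec \<gamma> \<in> age_vs.span (?V n)"
  proof (cases "finite E")
    \<comment> \<open>For finite \<open>E\<close> multiplication by the vertex is not injective, but
      there are no types of size above \<open>card E\<close>, so the claim is vacuous.\<close>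
    case True
    have "?T (Suc n) = {}" if "card E \<le> n" for n
    proof -
      have "card Q \<noteq> Suc n" if "Q \<subseteq> E" for Q
        using card_mono[OF True that] \<open>card E \<le> n\<close> by simp
      then show ?thesis by (auto simp: types_of_size_def)
    qed
    then show ?thesis by (intro that[of "card E"]) simp
  next
    case False
    obtain B where "\<And>n. profile E \<rho> n \<le> B" using assms by (auto simp: bounded_profile_def)
    then obtain N where const: "\<And>n. N \<le> n \<Longrightarrow> profile E \<rho> n = profile E \<rho> N"
      using mono_bounded_eventually_constant[of "profile E \<rho>" B] profile_mono[OF False] by metis
    have "profile E \<rho> n = profile E \<rho> (Suc n)" if "N \<le> n" for n
      unfolding const[OF that] const[OF le_SucI[OF that]] ..
    then show ?thesis by (intro that[of N] basis_vec_in_span_mult_vertex[OF False])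
  qed
  \<comment> \<open>Going up to \<open>Suc N\<close> rather than \<open>N\<close> puts size 1, and
    with it the vertex, among the generators even if \<open>N = 0\<close>.\<close>
  define S :: "('a set set \<Rightarrow>\<^sub>0 'k) set" where "S = (\<Union>n\<le>Suc N. basis_vec ` ?T n)"
  let ?G = "age_generated E \<rho> S"
  have low: "basis_vec ` ?T n \<subseteq> ?G" if "n \<le> Suc N" for n
  proof -
    have "basis_vec ` ?T n \<subseteq> S" unfolding S_def using that by (intro UN_upper) simp
    then show ?thesis using age_generated.incl[of _ S E \<rho>] by (rule order_trans[OF _ subsetI])
  qed
  have e: "age_vertex E \<rho> \<in> ?G"
    unfolding age_vertex_def all_types_def
    by (intro age_vs.subspace_sum[OF subspace_age_generated] subsetD[OF low[of 1]]) simp_all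
  have step: "basis_vec ` ?T (Suc n) \<subseteq> ?G" if "N \<le> n" "basis_vec ` ?T n \<subseteq> ?G" for n
  proof -
    have "?V n \<subseteq> ?G"
      unfolding image_image
      by (intro image_subsetI age_generated.mult[OF e]) (rule subsetD[OF that(2)], rule imageI)
    then have "age_vs.span (?V n) \<subseteq> ?G" by (rule age_vs.span_minimal[OF _ subspace_age_generated])
    then show ?thesis using N[OF that(1)] by (intro image_subsetI) (rule subsetD)
  qed
  have all: "basis_vec ` ?T n \<subseteq> ?G" for n
  proof (induction n)
    case (Suc n)
    then show ?case
    proof (cases "N \<le> n")
      case True
      then show ?thesis by (rule step) (rule Suc.IH)
    next
      case False
      then show ?thesis by (intro low) simp
    qed
  qed (rule low, simp)
  have "basis_vec ` age E \<rho> \<subseteq> ?G"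
  proof (rule subsetI)
    fix f assume "f \<in> (basis_vec ` age E \<rho> :: ('a set set \<Rightarrow>\<^sub>0 'k) set)"
    then obtain Q where "Q \<subseteq> E" "finite Q" "f = basis_vec (iso_type E \<rho> Q)" by (auto simp: age_def)
    then show "f \<in> ?G" using all[of "card Q"] iso_type_in_types_of_size_iff[of Q E \<rho> "card Q"] by auto
  qed
  then have "age_vs.span (basis_vec ` age E \<rho>) \<subseteq> ?G"
    by (rule age_vs.span_minimal[OF _ subspace_age_generated])
  moreover have "age_space E \<rho> \<subseteq> age_vs.span (basis_vec ` age E \<rho>)"
    unfolding age_space_def by (rule subsetI, rule in_span_basis_vecs) simp
  ultimately have "age_space E \<rho> \<subseteq> ?G" by (rule order_trans[rotated])
  moreover have S: "S \<subseteq> age_space E \<rho>"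
    by (auto simp: S_def age_space_def intro: subsetD[OF types_of_size_subset_age])
  have "?G \<subseteq> age_space E \<rho>"
  proof (rule subsetI)
    fix f assume "f \<in> ?G"
    then show "f \<in> age_space E \<rho>"
    proof induction
      case (incl f)
      then show ?case using S by (rule subsetD[rotated])
    qed (intro age_one_closed age_add_closed age_scale_closed age_mult_closed; assumption)+
  qed
  moreover have "finite S" unfolding S_def by (intro finite_UN_I finite_basis_vecs) simp
  ultimately show ?thesis
    using S unfolding age_algebra_finitely_generated_def by (intro exI[of _ S]) simp
qed

section \<open>Disjoint 3-cycles\<close>

definition cycle3 :: "'a rel \<Rightarrow> 'a \<Rightarrow> 'a \<Rightarrow> 'a \<Rightarrow> bool" where
  "cycle3 \<rho> x y z \<longleftrightarrow> (x, y) \<in> \<rho> \<and> (y, z) \<in> \<rho> \<and> (z, x) \<in> \<rho>"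

text \<open>Deleting each chosen 3-cycle before the next choice builds in disjointness. For a subset
  of a tournament, \<open>\<not> packs \<rho> 1 Q\<close> says that \<open>Q\<close> is linearly
  ordered.\<close>

fun packs :: "'a rel \<Rightarrow> nat \<Rightarrow> 'a set \<Rightarrow> bool" where
  "packs \<rho> 0 Q \<longleftrightarrow> True"
| "packs \<rho> (Suc k) Q \<longleftrightarrow>
    (\<exists>x\<in>Q. \<exists>y\<in>Q. \<exists>z\<in>Q. cycle3 \<rho> x y z \<and> packs \<rho> k (Q - {x, y, z}))"

lemma packs_mono: "packs \<rho> k Q \<Longrightarrow> Q \<subseteq> R \<Longrightarrow> packs \<rho> k R"
proof (induction k arbitrary: Q R)
  case (Suc k)
  then obtain x y z where xyz: "x \<in> Q" "y \<in> Q" "z \<in> Q" "cycle3 \<rho> x y z" "packs \<rho> k (Q - {x, y, z})"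
    by auto
  have "packs \<rho> k (R - {x, y, z})" using Suc.IH[OF xyz(5)] Suc.prems(2) by blast
  then show ?case using xyz Suc.prems(2) by auto
qed simp

text \<open>Needed for products, whose coefficients run over the splittings of \<open>Q\<close> into
  \<open>P\<close> and \<open>Q - P\<close>.\<close>

lemma packs_Un:
  "packs \<rho> k P \<Longrightarrow> packs \<rho> l R \<Longrightarrow> P \<inter> R = {} \<Longrightarrow> packs \<rho> (k + l) (P \<union> R)"
proof (induction k arbitrary: P)
  case 0
  then show ?case using packs_mono[of \<rho> l R "P \<union> R"] by simp
next
  case (Suc k)
  then obtain x y z where xyz: "x \<in> P" "y \<in> P" "z \<in> P" "cycle3 \<rho> x y z" "packs \<rho> k (P - {x, y, z})"
    by auto
  have "packs \<rho> (k + l) ((P - {x, y, z}) \<union> R)"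
    using Suc.IH[OF xyz(5) Suc.prems(2)] Suc.prems(3) by blast
  moreover have "(P - {x, y, z}) \<union> R = (P \<union> R) - {x, y, z}" using xyz(1-3) Suc.prems(3) by blast
  ultimately show ?case using xyz(1-4) by auto
qed

lemma packs_antimono:
  assumes "packs \<rho> l Q" "k \<le> l" shows "packs \<rho> k Q"
proof -
  have *: "packs \<rho> j Q" if "packs \<rho> (Suc j) Q" for j
    using that packs_mono[of \<rho> j _ Q] by auto
  from assms(2,1) show ?thesis
  proof (induction rule: dec_induct)
    case (step j)
    show ?case by (rule step.IH[OF *[OF step.prems]])
  qed
qed

text \<open>Disjoint 3-cycles use distinct points of \<open>U\<close>: deleting one of them deletes
  a point of \<open>U\<close>, while the rest of \<open>U\<close> still meets the remaining
  3-cycles.\<close>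

lemma not_packs_hitting_set:
  assumes "finite U" "\<And>x y z. x \<in> Q \<Longrightarrow> y \<in> Q \<Longrightarrow> z \<in> Q \<Longrightarrow> cycle3 \<rho> x y z \<Longrightarrow> {x, y, z} \<inter> U \<noteq> {}"
  shows "\<not> packs \<rho> (Suc (card U)) Q"
proof -
  have "k \<le> card U" if "packs \<rho> k Q" for k
    using that assms
  proof (induction k arbitrary: Q U)
    case (Suc k)
    then obtain x y z where xyz: "x \<in> Q" "y \<in> Q" "z \<in> Q" "cycle3 \<rho> x y z" "packs \<rho> k (Q - {x, y, z})"
      by auto
    have "k \<le> card (U - {x, y, z})"
    proof (rule Suc.IH[OF xyz(5)])
      show "finite (U - {x, y, z})" using Suc.prems(2) by simp
    next
      fix u v w assume "u \<in> Q - {x, y, z}" "v \<in> Q - {x, y, z}" "w \<in> Q - {x, y, z}" "cycle3 \<rho> u v w"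
      then show "{u, v, w} \<inter> (U - {x, y, z}) \<noteq> {}" using Suc.prems(3)[of u v w] by auto
    qed
    also have "\<dots> < card U"
      using Suc.prems(2) Suc.prems(3)[OF xyz(1-4)] by (intro psubset_card_mono) auto
    finally show ?case by simp
  qed simp
  from this[of "Suc (card U)"] show ?thesis by auto
qed

text \<open>In a tournament every failure of transitivity is a 3-cycle. Without 3-cycles the
  relation is therefore a strict linear order, determined up to isomorphism by its size.\<close>

lemma acyclic_iso_type_eq:
  assumes T: "tournament E \<rho>" and P: "P \<subseteq> E" "finite P" "\<not> packs \<rho> 1 P"
    and Q: "Q \<subseteq> E" "finite Q" "\<not> packs \<rho> 1 Q" and card: "card P = card Q"
  shows "iso_type E \<rho> P = iso_type E \<rho> Q"
proof -
  have chain: "digraph_isomorphic P (induced \<rho> P) {..<card P} {(i, j). i < j}"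
    if P: "P \<subseteq> E" "finite P" "\<not> packs \<rho> 1 P" for P
  proof -
    have irr: "(x, x) \<notin> \<rho>" for x using T by (auto simp: tournament_def irrefl_def)
    have tot: "(x, y) \<in> \<rho> \<longleftrightarrow> (y, x) \<notin> \<rho>" if "x \<in> P" "y \<in> P" "x \<noteq> y" for x y
      using T that P(1) by (auto simp: tournament_def)
    have tr: "(x, z) \<in> \<rho>" if "x \<in> P" "y \<in> P" "z \<in> P" "(x, y) \<in> \<rho>" "(y, z) \<in> \<rho>" for x y z
    proof -
      have "x \<noteq> y" using irr[of x] that(4) by blast
      then have "x \<noteq> z" using tot[OF that(1,2)] that(4,5) by blast
      moreover have "\<not> cycle3 \<rho> x y z" using P(3) that(1-3) by auto
      ultimately show ?thesis using tot[OF that(1,3)] that(4,5) unfolding cycle3_def by blast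
    qed
    \<comment> \<open>The number of predecessors is the position of \<open>x\<close> in the linear
      order.\<close>
    define f where "f x = card {w \<in> P. (w, x) \<in> \<rho>}" for x
    have less: "f x < f y" if "x \<in> P" "y \<in> P" "(x, y) \<in> \<rho>" for x y
      unfolding f_def
    proof (rule psubset_card_mono)
      show "finite {w \<in> P. (w, y) \<in> \<rho>}" using P(2) by simp
      show "{w \<in> P. (w, x) \<in> \<rho>} \<subset> {w \<in> P. (w, y) \<in> \<rho>}"
        using tr[OF _ that(1,2) _ that(3)] irr[of x] that by blast
    qed
    have iff: "(x, y) \<in> \<rho> \<longleftrightarrow> f x < f y" if "x \<in> P" "y \<in> P" for x y
      using less[OF that] less[OF that(2,1)] tot[OF that] irr[of x] by (cases "x = y") auto
    have "inj_on f P"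
    proof (rule inj_onI, rule ccontr)
      fix x y assume xy: "x \<in> P" "y \<in> P" "f x = f y" "x \<noteq> y"
      then show False using tot[of x y] iff[of x y] iff[of y x] by simp
    qed
    moreover have "f ` P \<subseteq> {..<card P}"
      unfolding f_def using irr P(2) by (intro image_subsetI, simp) (rule psubset_card_mono, auto)
    ultimately have "bij_betw f P {..<card P}"
      by (simp add: bij_betw_def card_image card_subset_eq)
    then show ?thesis
      unfolding digraph_isomorphic_def using iff by (intro exI[of _ f]) (auto simp: induced_def)
  qed
  have "digraph_isomorphic P (induced \<rho> P) Q (induced \<rho> Q)"
    using digraph_isomorphic_trans[OF chain[OF P, unfolded card] digraph_isomorphic_sym[OF chain[OF Q]]] .
  then show ?thesis by (rule iso_type_eqI)
qed

section \<open>Finite generation bounds the types with few disjoint 3-cycles\<close>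

text \<open>Designed for products of \<open>k\<close> elements that vanish on acyclic types and have
  sizes at most \<open>d\<close>: both the size bound and the number of disjoint 3-cycles add up
  under multiplication. For \<open>k = 0\<close> only the empty type is left, which gives the
  scalars.\<close>

definition packed_part :: "'a set \<Rightarrow> 'a rel \<Rightarrow> nat \<Rightarrow> nat \<Rightarrow> ('a set set \<Rightarrow>\<^sub>0 'k::field) set" where
  "packed_part E \<rho> d k = {f \<in> age_space E \<rho>. \<forall>Q\<subseteq>E. finite Q \<longrightarrow>
     Poly_Mapping.lookup f (iso_type E \<rho> Q) \<noteq> 0 \<longrightarrow> card Q \<le> k * d \<and> packs \<rho> k Q}"

lemma packed_partD:
  assumes "f \<in> packed_part E \<rho> d k" "Q \<subseteq> E" "finite Q"
    "Poly_Mapping.lookup f (iso_type E \<rho> Q) \<noteq> 0"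
  shows "card Q \<le> k * d" "packs \<rho> k Q"
  using assms unfolding packed_part_def by blast+

lemma packed_part_mult:
  assumes f: "f \<in> packed_part E \<rho> d k" and g: "g \<in> packed_part E \<rho> d l"
  shows "age_mult E \<rho> f g \<in> packed_part E \<rho> d (k + l)"
  unfolding packed_part_def
proof (intro CollectI conjI allI impI age_mult_closed)
  fix Q assume Q: "Q \<subseteq> E" "finite Q"
  assume "Poly_Mapping.lookup (age_mult E \<rho> f g) (iso_type E \<rho> Q) \<noteq> 0"
  then obtain P where P: "P \<subseteq> Q" "Poly_Mapping.lookup f (iso_type E \<rho> P) \<noteq> 0"
    "Poly_Mapping.lookup g (iso_type E \<rho> (Q - P)) \<noteq> 0"
    unfolding lookup_age_mult[OF Q] by (elim sum.not_neutral_contains_not_neutral) auto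
  have sub: "P \<subseteq> E" "finite P" "Q - P \<subseteq> E" "finite (Q - P)" and Q': "Q = P \<union> (Q - P)"
    using P(1) Q by (auto intro: finite_subset)
  note fP = packed_partD[OF f sub(1,2) P(2)] and gP = packed_partD[OF g sub(3,4) P(3)]
  have "card Q \<le> card P + card (Q - P)" using card_Un_le[of P "Q - P"] Q' by simp
  then show "card Q \<le> (k + l) * d" using fP(1) gP(1) by (simp add: add_mult_distrib)
  have "packs \<rho> (k + l) (P \<union> (Q - P))" using fP(2) gP(2) by (rule packs_Un) blast
  then show "packs \<rho> (k + l) Q" using Q' by simp
qed

text \<open>This set is closed under products, so its span is a subalgebra once it contains the
  unit. It will be shown to contain the generators and hence everything.\<close>

definition vertex_packed :: "'a set \<Rightarrow> 'a rel \<Rightarrow> nat \<Rightarrow> ('a set set \<Rightarrow>\<^sub>0 'k::field) set" where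
  "vertex_packed E \<rho> d = range (age_mult E \<rho> (age_vertex E \<rho>)) \<union> (\<Union>k. packed_part E \<rho> d k)"

lemma vertex_packed_mult:
  assumes "f \<in> vertex_packed E \<rho> d" "g \<in> vertex_packed E \<rho> d"
  shows "age_mult E \<rho> f g \<in> vertex_packed E \<rho> d"
proof -
  have ideal: "age_mult E \<rho> (age_mult E \<rho> (age_vertex E \<rho>) h) h' \<in> vertex_packed E \<rho> d" for h h'
    unfolding age_mult_assoc vertex_packed_def by blast
  consider h where "f = age_mult E \<rho> (age_vertex E \<rho>) h" | h where "g = age_mult E \<rho> (age_vertex E \<rho>) h"
    | k l where "f \<in> packed_part E \<rho> d k" "g \<in> packed_part E \<rho> d l"
    using assms unfolding vertex_packed_def by blast
  then show ?thesis
  proof cases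
    case 2
    show ?thesis unfolding age_mult_commute[of E \<rho> f g] unfolding 2 by (rule ideal)
  next
    case 3
    from packed_part_mult[OF this] show ?thesis unfolding vertex_packed_def by blast
  qed (simp add: ideal)
qed

lemma span_mult_closed:
  assumes closed: "\<And>f g. f \<in> B \<Longrightarrow> g \<in> B \<Longrightarrow> age_mult E \<rho> f g \<in> B"
    and f: "f \<in> age_vs.span B" and g: "g \<in> age_vs.span B"
  shows "age_mult E \<rho> f g \<in> age_vs.span B"
proof -
  have lin: "age_mult E \<rho> f h \<in> age_vs.span B"
    if "h \<in> age_vs.span B" "\<And>g. g \<in> B \<Longrightarrow> age_mult E \<rho> f g \<in> age_vs.span B" for f h
  proof -
    interpret m: Vector_Spaces.linear age_scale age_scale "age_mult E \<rho> f" by (rule linear_age_mult)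
    show ?thesis
      using that(1)
    proof (induction rule: age_vs.span_induct_alt)
      case (step c x y)
      then show ?case
        unfolding m.add m.scale by (rule age_vs.span_add[OF age_vs.span_scale[OF that(2)]])
    qed (simp add: m.zero age_vs.span_zero)
  qed
  show ?thesis
  proof (rule lin[OF g])
    fix h assume h: "h \<in> B"
    have "age_mult E \<rho> h f \<in> age_vs.span B"
      by (rule lin[OF f]) (intro age_vs.span_base closed h)
    then show "age_mult E \<rho> f h \<in> age_vs.span B" by (simp only: age_mult_commute[of E \<rho> f h])
  qed
qed

text \<open>For \<open>n = 0\<close> this is the unit, which lies in
  \<open>packed_part E \<rho> d 0\<close>; for larger \<open>n\<close> it is a multiple of the
  vertex.\<close>

lemma all_types_in_span_vertex_packed:
  "(all_types E \<rho> n :: 'a set set \<Rightarrow>\<^sub>0 'k::field_char_0) \<in> age_vs.span (vertex_packed E \<rho> d)"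
proof (cases n)
  case 0
  have "(all_types E \<rho> 0 :: 'a set set \<Rightarrow>\<^sub>0 'k) \<in> packed_part E \<rho> d 0"
    unfolding packed_part_def by (auto simp: all_types_closed lookup_all_types split: if_splits)
  then show ?thesis unfolding 0 vertex_packed_def by (intro age_vs.span_base) blast
next
  case (Suc k)
  show ?thesis
    unfolding Suc all_types_Suc vertex_packed_def
    by (intro age_vs.span_scale age_vs.span_base) blast
qed

lemma age_one_eq_all_types: "age_one E \<rho> = all_types E \<rho> 0"
proof -
  have "types_of_size E \<rho> (\<lambda>_. True) 0 = {iso_type E \<rho> {}}"
    by (auto simp: types_of_size_def)
  then show ?thesis by (simp add: age_one_def all_types_def)
qed

text \<open>
  Subtracting a combination of the \<open>all_types E \<rho> n\<close>, which for \<open>n > 0\<close> are multiples of the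
  vertex, makes \<open>f\<close> vanish on the acyclic types.
\<close>
lemma in_span_vertex_packed:
  fixes f :: "'a set set \<Rightarrow>\<^sub>0 'k::field_char_0"
  assumes T: "tournament E \<rho>" and f: "f \<in> age_space E \<rho>"
    and deg: "\<And>Q. Q \<subseteq> E \<Longrightarrow> finite Q \<Longrightarrow> Poly_Mapping.lookup f (iso_type E \<rho> Q) \<noteq> 0 \<Longrightarrow> card Q \<le> d"
  shows "f \<in> age_vs.span (vertex_packed E \<rho> d)"
proof -
  \<comment> \<open>The coefficient of \<open>f\<close> at the unique acyclic type of size
    \<open>n\<close>. If there is none, the value is arbitrary, which is harmless: it then only
    changes \<open>f\<close> at types that contain a 3-cycle.\<close>
  define \<phi> where "\<phi> n = Poly_Mapping.lookup f (iso_type E \<rho>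
    (SOME Q. Q \<subseteq> E \<and> finite Q \<and> card Q = n \<and> \<not> packs \<rho> 1 Q))" for n
  have \<phi>: "\<phi> (card Q) = Poly_Mapping.lookup f (iso_type E \<rho> Q)"
    if Q: "Q \<subseteq> E" "finite Q" "\<not> packs \<rho> 1 Q" for Q
  proof -
    define R where "R = (SOME R. R \<subseteq> E \<and> finite R \<and> card R = card Q \<and> \<not> packs \<rho> 1 R)"
    have "R \<subseteq> E \<and> finite R \<and> card R = card Q \<and> \<not> packs \<rho> 1 R"
      unfolding R_def by (rule someI[of _ Q]) (use Q in blast)
    then have "iso_type E \<rho> R = iso_type E \<rho> Q"
      using acyclic_iso_type_eq[OF T _ _ _ Q] by blast
    then show ?thesis unfolding \<phi>_def R_def[symmetric] by simp
  qed
  define h where "h = (\<Sum>n\<le>d. age_scale (\<phi> n) (all_types E \<rho> n))"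
  have h_span: "h \<in> age_vs.span (vertex_packed E \<rho> d)"
    unfolding h_def by (intro age_vs.span_sum age_vs.span_scale all_types_in_span_vertex_packed)
  have h_closed: "h \<in> age_space E \<rho>"
    unfolding h_def by (intro age_vs.subspace_sum[OF subspace_age_space] age_scale_closed all_types_closed)
  have h: "Poly_Mapping.lookup h (iso_type E \<rho> Q) = (if card Q \<le> d then \<phi> (card Q) else 0)"
    if "Q \<subseteq> E" "finite Q" for Q
    unfolding h_def lookup_sum lookup_age_scale lookup_all_types[OF that]
    by (simp add: if_distrib[of "(*) _"] sum.delta cong: if_cong)
  have "f - h \<in> packed_part E \<rho> d 1"
    unfolding packed_part_def
  proof (intro CollectI conjI allI impI age_vs.subspace_diff[OF subspace_age_space f h_closed])
    fix Q assume Q: "Q \<subseteq> E" "finite Q"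
    assume "Poly_Mapping.lookup (f - h) (iso_type E \<rho> Q) \<noteq> 0"
    then have ne: "Poly_Mapping.lookup f (iso_type E \<rho> Q) \<noteq> (if card Q \<le> d then \<phi> (card Q) else 0)"
      by (simp add: lookup_minus h[OF Q])
    then show "card Q \<le> 1 * d" using deg[OF Q] by (cases "card Q \<le> d") auto
    then show "packs \<rho> 1 Q" using ne \<phi>[OF Q] by (cases "packs \<rho> 1 Q") auto
  qed
  then have "f - h \<in> age_vs.span (vertex_packed E \<rho> d)"
    unfolding vertex_packed_def by (intro age_vs.span_base) blast
  from age_vs.span_add[OF this h_span] show ?thesis by simp
qed

lemma finite_degree_bound:
  fixes S :: "('a set set \<Rightarrow>\<^sub>0 'k::field) set"
  assumes "finite S"
  obtains d where "\<And>f Q. f \<in> S \<Longrightarrow> Q \<subseteq> E \<Longrightarrow> finite Q \<Longrightarrow>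
    Poly_Mapping.lookup f (iso_type E \<rho> Q) \<noteq> 0 \<Longrightarrow> card Q \<le> d"
proof -
  define K where "K = (\<Union>f\<in>S. Poly_Mapping.keys f)"
  define size where "size \<gamma> = card (SOME Q. Q \<in> \<gamma>)" for \<gamma> :: "'a set set"
  have size: "size (iso_type E \<rho> Q) = card Q" if Q: "Q \<subseteq> E" "finite Q" for Q
  proof -
    have "(SOME R. R \<in> iso_type E \<rho> Q) \<in> iso_type E \<rho> Q"
      using iso_type_self[OF Q] by (rule someI)
    then show ?thesis
      using Q unfolding size_def iso_type_def digraph_isomorphic_def by (auto dest: bij_betw_same_card)
  qed
  have fin: "finite K" using assms by (simp add: K_def)
  \<comment> \<open>The sum of the finitely many sizes is a crude common bound.\<close>
  have "card Q \<le> (\<Sum>\<gamma>\<in>K. size \<gamma>)"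
    if "f \<in> S" "Q \<subseteq> E" "finite Q" "Poly_Mapping.lookup f (iso_type E \<rho> Q) \<noteq> 0" for f Q
  proof -
    have "iso_type E \<rho> Q \<in> K" using that by (auto simp: K_def in_keys_iff)
    from member_le_sum[OF this _ fin, of size] show ?thesis using size[OF that(2,3)] by simp
  qed
  then show ?thesis by (rule that)
qed

text \<open>Projecting onto the types in \<open>T (Suc n)\<close> kills every packed part and makes
  a multiple of the vertex depend only on the coefficients at \<open>T n\<close>. The image, which
  contains all basis vectors of \<open>T (Suc n)\<close>, is thus spanned by at most
  \<open>card (T n)\<close> vectors.\<close>

lemma card_types_decreasing:
  fixes E :: "'a set" and \<rho> :: "'a rel" and m :: nat
  defines "T \<equiv> types_of_size E \<rho> (\<lambda>Q. \<not> packs \<rho> (Suc m) Q)"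
  assumes span: "age_space E \<rho> \<subseteq>
      (age_vs.span (vertex_packed E \<rho> d) :: ('a set set \<Rightarrow>\<^sub>0 'k::field_char_0) set)"
    and n: "m * d \<le> n"
  shows "card (T (Suc n)) \<le> card (T n)"
proof -
  let ?e = "\<lambda>f :: 'a set set \<Rightarrow>\<^sub>0 'k. age_mult E \<rho> (age_vertex E \<rho>) f"
  define \<pi> where "\<pi> n f = (\<Sum>\<gamma>\<in>T n. age_scale (Poly_Mapping.lookup f \<gamma>) (basis_vec \<gamma>))"
    for n and f :: "'a set set \<Rightarrow>\<^sub>0 'k"
  have finT: "finite (T n)" for n unfolding T_def by (rule finite_types_of_size)
  have lookup_\<pi>: "Poly_Mapping.lookup (\<pi> n f) \<gamma> = (if \<gamma> \<in> T n then Poly_Mapping.lookup f \<gamma> else 0)" for n f \<gamma>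
    unfolding \<pi>_def lookup_sum lookup_age_scale
    by (simp add: lookup_single when_def if_distrib[of "(*) _"] sum.delta finT cong: if_cong)
  interpret e: Vector_Spaces.linear age_scale age_scale ?e by (rule linear_age_mult)
  interpret \<pi>: Vector_Spaces.linear age_scale age_scale "\<pi> (Suc n)"
    by (simp add: Vector_Spaces.linear_iff age_vs.vector_space_axioms)
      (auto intro!: poly_mapping_eqI simp: lookup_\<pi> lookup_add lookup_age_scale)
  define W where "W = (\<lambda>\<delta>. \<pi> (Suc n) (?e (basis_vec \<delta>))) ` T n"
  have "\<pi> (Suc n) f \<in> age_vs.span W" if "f \<in> vertex_packed E \<rho> d" for f
    using that unfolding vertex_packed_def
  proof (elim UnE UN_E rangeE)
    fix k assume f: "f \<in> packed_part E \<rho> d k"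
    \<comment> \<open>A set without \<open>m + 1\<close> disjoint 3-cycles forces \<open>k\<close>
      to be at most \<open>m\<close>, hence size at most \<open>m * d\<close>, which is less than
      \<open>Suc n\<close>.\<close>
    have "Poly_Mapping.lookup f \<gamma> = 0" if "\<gamma> \<in> T (Suc n)" for \<gamma>
    proof (rule ccontr)
      assume nz: "Poly_Mapping.lookup f \<gamma> \<noteq> 0"
      obtain Q where Q: "Q \<subseteq> E" "finite Q" "\<not> packs \<rho> (Suc m) Q" "card Q = Suc n" "\<gamma> = iso_type E \<rho> Q"
        using \<open>\<gamma> \<in> T (Suc n)\<close> unfolding T_def by (rule types_of_sizeE)
      note kQ = packed_partD[OF f Q(1,2) nz[unfolded Q(5)]]
      have "\<not> Suc m \<le> k" using packs_antimono[OF kQ(2), of "Suc m"] Q(3) by blast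
      then have "k \<le> m" by simp
      then have "k * d \<le> m * d" by (rule mult_le_mono1)
      then show False using kQ(1) Q(4) n by linarith
    qed
    then have "\<pi> (Suc n) f = 0" by (simp add: \<pi>_def)
    then show ?thesis by (simp add: age_vs.span_zero)
  next
    fix g assume f: "f = ?e g"
    \<comment> \<open>Deleting a vertex creates no 3-cycles, so the deletions of a set with type in
      \<open>T (Suc n)\<close> have types in \<open>T n\<close>.\<close>
    have "Poly_Mapping.lookup (?e g) \<gamma> = Poly_Mapping.lookup (?e (\<pi> n g)) \<gamma>" if "\<gamma> \<in> T (Suc n)" for \<gamma>
    proof -
      obtain Q where Q: "Q \<subseteq> E" "finite Q" "\<not> packs \<rho> (Suc m) Q" "card Q = Suc n" "\<gamma> = iso_type E \<rho> Q"
        using \<open>\<gamma> \<in> T (Suc n)\<close> unfolding T_def by (rule types_of_sizeE)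
      have "iso_type E \<rho> (Q - {x}) \<in> T n" if "x \<in> Q" for x
      proof -
        have "\<not> packs \<rho> (Suc m) (Q - {x})" using Q(3) packs_mono[OF _ Diff_subset] by blast
        moreover have "card (Q - {x}) = n" using Q(4) card_Diff_singleton[OF that] by simp
        moreover have "Q - {x} \<subseteq> E" "finite (Q - {x})" using Q(1,2) by auto
        ultimately show ?thesis unfolding T_def by (intro types_of_sizeI)
      qed
      then show ?thesis unfolding Q(5) lookup_mult_vertex[OF Q(1,2)] by (simp add: lookup_\<pi>)
    qed
    then have "\<pi> (Suc n) f = \<pi> (Suc n) (?e (\<pi> n g))" unfolding f by (simp add: \<pi>_def)
    also have "\<dots> = (\<Sum>\<delta>\<in>T n. age_scale (Poly_Mapping.lookup g \<delta>) (\<pi> (Suc n) (?e (basis_vec \<delta>))))"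
      by (simp add: \<pi>_def[of n] e.sum \<pi>.sum e.scale \<pi>.scale)
    also have "\<dots> \<in> age_vs.span W"
      unfolding W_def by (intro age_vs.span_sum age_vs.span_scale age_vs.span_base imageI)
    finally show ?thesis .
  qed
  then have "\<pi> (Suc n) ` vertex_packed E \<rho> d \<subseteq> age_vs.span W" by (rule image_subsetI)
  then have "age_vs.span (\<pi> (Suc n) ` vertex_packed E \<rho> d) \<subseteq> age_vs.span W"
    by (rule age_vs.span_minimal) (rule age_vs.subspace_span)
  then have \<pi>_span: "\<pi> (Suc n) f \<in> age_vs.span W" if "f \<in> age_space E \<rho>" for f
  proof -
    have "\<pi> (Suc n) f \<in> age_vs.span (\<pi> (Suc n) ` vertex_packed E \<rho> d)"
      unfolding \<pi>.span_image by (rule imageI) (rule subsetD[OF span that])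
    then show ?thesis using \<open>age_vs.span (\<pi> (Suc n) ` vertex_packed E \<rho> d) \<subseteq> age_vs.span W\<close>
      by (rule subsetD[rotated])
  qed
  have sub: "basis_vec ` T (Suc n) \<subseteq> age_vs.span W"
  proof (rule image_subsetI)
    fix \<gamma> assume \<gamma>: "\<gamma> \<in> T (Suc n)"
    then have "basis_vec \<gamma> \<in> age_space E \<rho>"
      using subsetD[OF types_of_size_subset_age] by (simp add: T_def age_space_def)
    from \<pi>_span[OF this] show "basis_vec \<gamma> \<in> age_vs.span W"
    proof (rule back_subst[of "\<lambda>f. f \<in> age_vs.span W"])
      show "\<pi> (Suc n) (basis_vec \<gamma>) = basis_vec \<gamma>"
        using \<gamma> by (intro poly_mapping_eqI) (auto simp: lookup_\<pi> lookup_single when_def)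
    qed
  qed
  have "finite W" unfolding W_def by (intro finite_imageI finT)
  then have "card (basis_vec ` T (Suc n) :: ('a set set \<Rightarrow>\<^sub>0 'k) set) \<le> card W"
    using age_vs.independent_span_bound[OF _ independent_basis_vecs sub] by simp
  also have "\<dots> \<le> card (T n)" unfolding W_def by (rule card_image_le) (rule finT)
  finally show ?thesis by (simp only: card_basis_vecs)
qed

lemma bounded_types_if_finitely_generated:
  assumes T: "tournament E \<rho>"
    and fg: "age_algebra_finitely_generated TYPE('k::field_char_0) E \<rho>"
  obtains B where "\<And>n. card (types_of_size E \<rho> (\<lambda>Q. \<not> packs \<rho> (Suc m) Q) n) \<le> B"
proof -
  define t where "t n = card (types_of_size E \<rho> (\<lambda>Q. \<not> packs \<rho> (Suc m) Q) n)" for n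
  obtain S :: "('a set set \<Rightarrow>\<^sub>0 'k) set" where S: "finite S" "S \<subseteq> age_space E \<rho>"
    "age_generated E \<rho> S = age_space E \<rho>"
    using fg unfolding age_algebra_finitely_generated_def by blast
  obtain d where d: "\<And>f Q. f \<in> S \<Longrightarrow> Q \<subseteq> E \<Longrightarrow> finite Q \<Longrightarrow>
    Poly_Mapping.lookup f (iso_type E \<rho> Q) \<noteq> 0 \<Longrightarrow> card Q \<le> d"
    using finite_degree_bound[OF S(1), of E \<rho>] by metis
  have "age_generated E \<rho> S \<subseteq> age_vs.span (vertex_packed E \<rho> d)"
  proof (rule subsetI)
    fix f assume "f \<in> age_generated E \<rho> S"
    then show "f \<in> age_vs.span (vertex_packed E \<rho> d)"
    proof induction
      case one
      then show ?case unfolding age_one_eq_all_types by (rule all_types_in_span_vertex_packed)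
    next
      case (incl f)
      then show ?case using S(2) d by (intro in_span_vertex_packed[OF T]) auto
    next
      case (mult f g)
      show ?case by (rule span_mult_closed[OF vertex_packed_mult mult.IH])
    qed (intro age_vs.span_add age_vs.span_scale; assumption)+
  qed
  then have dec: "t (Suc n) \<le> t n" if "m * d \<le> n" for n
    unfolding t_def using S(3) by (intro card_types_decreasing[OF _ that]) simp
  \<comment> \<open>From \<open>m * d\<close> on the counts no longer increase, so the finitely many
    earlier values bound all of them.\<close>
  have "t n \<le> (\<Sum>i\<le>m * d. t i)" for n
  proof (cases "n \<le> m * d")
    case True
    then show ?thesis by (intro member_le_sum) auto
  next
    case False
    then have "m * d \<le> n" by simp
    then have "t n \<le> t (m * d)"
      by (induction rule: dec_induct) (auto intro: order_trans[OF dec])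
    also have "\<dots> \<le> (\<Sum>i\<le>m * d. t i)" by (intro member_le_sum) auto
    finally show ?thesis .
  qed
  then show ?thesis using that unfolding t_def by blast
qed

section \<open>Two isomorphism invariants\<close>

text \<open>The triples are ordered, so each 3-cycle occurs in its three rotations; this is the
  factor 3 in \<open>blown_up_cycle_invariants\<close>.\<close>

definition cycles3 :: "'a rel \<Rightarrow> 'a set \<Rightarrow> ('a \<times> 'a \<times> 'a) set" where
  "cycles3 \<rho> Q = {(x, y, z). x \<in> Q \<and> y \<in> Q \<and> z \<in> Q \<and> cycle3 \<rho> x y z}"

text \<open>In a blown-up 3-cycle with nonempty \<open>A\<close>, \<open>B\<close>, \<open>C\<close>
  this set recovers \<open>W\<close>, whose size thereby becomes an isomorphism invariant.\<close>

definition cycle_dominators :: "'a rel \<Rightarrow> 'a set \<Rightarrow> 'a set" where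
  "cycle_dominators \<rho> Q =
    {w \<in> Q. \<exists>(x, y, z) \<in> cycles3 \<rho> Q. (w, x) \<in> \<rho> \<and> (w, y) \<in> \<rho> \<and> (w, z) \<in> \<rho>}"

lemma finite_cycles3: "finite Q \<Longrightarrow> finite (cycles3 \<rho> Q)"
  by (rule finite_subset[of _ "Q \<times> Q \<times> Q"]) (auto simp: cycles3_def)

lemma card_invariants_le:
  assumes "digraph_isomorphic P (induced \<rho> P) Q (induced \<rho> Q)" "finite Q"
  shows "card (cycles3 \<rho> P) \<le> card (cycles3 \<rho> Q)"
    and "card (cycle_dominators \<rho> P) \<le> card (cycle_dominators \<rho> Q)"
proof -
  obtain f where bij: "bij_betw f P Q"
    and f: "\<forall>x\<in>P. \<forall>y\<in>P. (x, y) \<in> induced \<rho> P \<longleftrightarrow> (f x, f y) \<in> induced \<rho> Q"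
    using assms unfolding digraph_isomorphic_def by blast
  have mem: "f x \<in> Q" if "x \<in> P" for x
    using bij that by (rule bij_betw_apply)
  have edge: "(f x, f y) \<in> \<rho> \<longleftrightarrow> (x, y) \<in> \<rho>" if "x \<in> P" "y \<in> P" for x y
    using f that mem[OF that(1)] mem[OF that(2)] by (auto simp: induced_def)
  have img: "(f x, f y, f z) \<in> cycles3 \<rho> Q" if "(x, y, z) \<in> cycles3 \<rho> P" for x y z
    using that mem edge by (auto simp: cycles3_def cycle3_def)
  have inj: "inj_on f P" using bij by (rule bij_betw_imp_inj_on)
  show "card (cycles3 \<rho> P) \<le> card (cycles3 \<rho> Q)"
  proof (rule card_inj_on_le[of "\<lambda>(x, y, z). (f x, f y, f z)"])
    show "inj_on (\<lambda>(x, y, z). (f x, f y, f z)) (cycles3 \<rho> P)"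
      by (rule inj_onI) (auto simp: cycles3_def dest: inj_onD[OF inj])
    show "(\<lambda>(x, y, z). (f x, f y, f z)) ` cycles3 \<rho> P \<subseteq> cycles3 \<rho> Q"
      using img by auto
  qed (rule finite_cycles3[OF assms(2)])
  show "card (cycle_dominators \<rho> P) \<le> card (cycle_dominators \<rho> Q)"
  proof (rule card_inj_on_le[of f])
    show "inj_on f (cycle_dominators \<rho> P)"
      by (rule inj_on_subset[OF inj]) (auto simp: cycle_dominators_def)
    show "f ` cycle_dominators \<rho> P \<subseteq> cycle_dominators \<rho> Q"
    proof (rule image_subsetI)
      fix w assume "w \<in> cycle_dominators \<rho> P"
      then obtain x y z where w: "w \<in> P" "(x, y, z) \<in> cycles3 \<rho> P"
        "(w, x) \<in> \<rho>" "(w, y) \<in> \<rho>" "(w, z) \<in> \<rho>"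
        by (auto simp: cycle_dominators_def)
      have "x \<in> P" "y \<in> P" "z \<in> P" using w(2) by (auto simp: cycles3_def)
      then have "(f w, f x) \<in> \<rho> \<and> (f w, f y) \<in> \<rho> \<and> (f w, f z) \<in> \<rho>" using w edge by simp
      then show "f w \<in> cycle_dominators \<rho> Q"
        using img[OF w(2)] mem[OF w(1)] unfolding cycle_dominators_def by blast
    qed
    show "finite (cycle_dominators \<rho> Q)" using assms(2) by (simp add: cycle_dominators_def)
  qed
qed

lemma card_invariants_eq:
  assumes "iso_type E \<rho> P = iso_type E \<rho> Q" "P \<subseteq> E" "finite P" "finite Q"
  shows "card (cycles3 \<rho> P) = card (cycles3 \<rho> Q)"
    and "card (cycle_dominators \<rho> P) = card (cycle_dominators \<rho> Q)"
proof -
  have iso: "digraph_isomorphic P (induced \<rho> P) Q (induced \<rho> Q)"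
    using assms iso_type_eq_iff by blast
  note iso' = digraph_isomorphic_sym[OF iso]
  show "card (cycles3 \<rho> P) = card (cycles3 \<rho> Q)"
    using card_invariants_le(1)[OF iso assms(4)] card_invariants_le(1)[OF iso' assms(3)] by simp
  show "card (cycle_dominators \<rho> P) = card (cycle_dominators \<rho> Q)"
    using card_invariants_le(2)[OF iso assms(4)] card_invariants_le(2)[OF iso' assms(3)] by simp
qed

section \<open>Blown-up 3-cycles\<close>

definition cycle_free :: "'a rel \<Rightarrow> 'a set \<Rightarrow> bool" where
  "cycle_free \<rho> X \<longleftrightarrow> (\<forall>x\<in>X. \<forall>y\<in>X. \<forall>z\<in>X. \<not> cycle3 \<rho> x y z)"

text \<open>Inside a tournament: a 3-cycle whose vertices are replaced by linear orders
  \<open>A\<close>, \<open>B\<close>, \<open>C\<close>, with a linear order \<open>W\<close>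
  dominating everything else and a linear order \<open>Z\<close> dominated by everything
  else.\<close>

definition blown_up_cycle :: "'a rel \<Rightarrow> 'a set \<Rightarrow> 'a set \<Rightarrow> 'a set \<Rightarrow> 'a set \<Rightarrow> 'a set \<Rightarrow> bool" where
  "blown_up_cycle \<rho> W A B C Z \<longleftrightarrow>
     (\<forall>X\<in>{W, A, B, C, Z}. cycle_free \<rho> X) \<and>
     W \<times> (A \<union> B \<union> C \<union> Z) \<subseteq> \<rho> \<and> (A \<union> B \<union> C) \<times> Z \<subseteq> \<rho> \<and>
     A \<times> B \<subseteq> \<rho> \<and> B \<times> C \<subseteq> \<rho> \<and> C \<times> A \<subseteq> \<rho>"

lemma tournament_asym: "tournament E \<rho> \<Longrightarrow> (x, y) \<in> \<rho> \<Longrightarrow> (y, x) \<notin> \<rho>"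
  unfolding tournament_def irrefl_def by (cases "x = y") blast+

lemma tournament_total:
  "tournament E \<rho> \<Longrightarrow> x \<in> E \<Longrightarrow> y \<in> E \<Longrightarrow> x \<noteq> y \<Longrightarrow> (x, y) \<notin> \<rho> \<Longrightarrow> (y, x) \<in> \<rho>"
  unfolding tournament_def by blast

lemma cycle_freeD:
  "cycle_free \<rho> X \<Longrightarrow> cycle3 \<rho> x y z \<Longrightarrow> x \<in> X \<Longrightarrow> y \<in> X \<Longrightarrow> z \<in> X \<Longrightarrow> False"
  by (simp add: cycle_free_def)

lemma cycle3_rotate: "cycle3 \<rho> x y z \<Longrightarrow> cycle3 \<rho> y z x"
  by (simp add: cycle3_def)

lemma blown_up_cycleI:
  assumes "cycle_free \<rho> W" "cycle_free \<rho> A" "cycle_free \<rho> B" "cycle_free \<rho> C" "cycle_free \<rho> Z"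
    and "W \<times> (A \<union> B \<union> C \<union> Z) \<subseteq> \<rho>" "(A \<union> B \<union> C) \<times> Z \<subseteq> \<rho>" "A \<times> B \<subseteq> \<rho>" "B \<times> C \<subseteq> \<rho>" "C \<times> A \<subseteq> \<rho>"
  shows "blown_up_cycle \<rho> W A B C Z"
  using assms unfolding blown_up_cycle_def by (simp only: ball_simps simp_thms)

text \<open>\<open>W\<close> is closed under predecessors and \<open>Z\<close> under successors, so
  a 3-cycle meeting one of them would lie inside it, which is excluded. In the middle an arc stays
  in its part or moves on in the cyclic order \<open>A\<close>, \<open>B\<close>, \<open>C\<close>;
  a 3-cycle cannot stay in one part, so it visits each once.\<close>

lemma blown_up_cycle_cycles3:
  assumes T: "tournament E \<rho>" and bl: "blown_up_cycle \<rho> W A B C Z"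
  shows "cycles3 \<rho> (W \<union> A \<union> B \<union> C \<union> Z) = A \<times> B \<times> C \<union> B \<times> C \<times> A \<union> C \<times> A \<times> B"
proof -
  let ?Q = "W \<union> A \<union> B \<union> C \<union> Z"
  note asym = tournament_asym[OF T]
  have ac: "cycle_free \<rho> W" "cycle_free \<rho> A" "cycle_free \<rho> B" "cycle_free \<rho> C" "cycle_free \<rho> Z"
    using bl by (simp_all only: blown_up_cycle_def ball_simps simp_thms)
  have arr: "W \<times> (A \<union> B \<union> C \<union> Z) \<subseteq> \<rho>" "(A \<union> B \<union> C) \<times> Z \<subseteq> \<rho>" "A \<times> B \<subseteq> \<rho>" "B \<times> C \<subseteq> \<rho>" "C \<times> A \<subseteq> \<rho>"
    using bl by (simp_all only: blown_up_cycle_def simp_thms)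
  have W: "x \<in> W" if "y \<in> W" "(x, y) \<in> \<rho>" "x \<in> ?Q" for x y
    using that arr(1) asym[of x y] by blast
  have Z: "y \<in> Z" if "x \<in> Z" "(x, y) \<in> \<rho>" "y \<in> ?Q" for x y
    using that arr(1,2) asym[of x y] by blast
  have notW: "x \<notin> W" if c: "cycle3 \<rho> x y z" "x \<in> ?Q" "y \<in> ?Q" "z \<in> ?Q" for x y z
  proof
    assume x: "x \<in> W"
    have z: "z \<in> W" using W[OF x _ c(4)] c(1) by (simp add: cycle3_def)
    have y: "y \<in> W" using W[OF z _ c(3)] c(1) by (simp add: cycle3_def)
    show False by (rule cycle_freeD[OF ac(1) c(1) x y z])
  qed
  have notZ: "x \<notin> Z" if c: "cycle3 \<rho> x y z" "x \<in> ?Q" "y \<in> ?Q" "z \<in> ?Q" for x y z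
  proof
    assume x: "x \<in> Z"
    have y: "y \<in> Z" using Z[OF x _ c(3)] c(1) by (simp add: cycle3_def)
    have z: "z \<in> Z" using Z[OF y _ c(4)] c(1) by (simp add: cycle3_def)
    show False by (rule cycle_freeD[OF ac(5) c(1) x y z])
  qed
  have mid: "x \<in> A \<union> B \<union> C" if "cycle3 \<rho> x y z" "x \<in> ?Q" "y \<in> ?Q" "z \<in> ?Q" for x y z
    using notW[OF that] notZ[OF that] that(2) by blast
  have succ: "x \<in> A \<Longrightarrow> y \<in> A \<union> B" "x \<in> B \<Longrightarrow> y \<in> B \<union> C" "x \<in> C \<Longrightarrow> y \<in> C \<union> A"
    if "(x, y) \<in> \<rho>" "y \<in> A \<union> B \<union> C" for x y
    using that arr(3-5) asym[of x y] by blast+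
  have sub: "(x, y, z) \<in> A \<times> B \<times> C \<union> B \<times> C \<times> A \<union> C \<times> A \<times> B"
    if c: "cycle3 \<rho> x y z" "x \<in> ?Q" "y \<in> ?Q" "z \<in> ?Q" for x y z
  proof -
    have m: "x \<in> A \<union> B \<union> C" "y \<in> A \<union> B \<union> C" "z \<in> A \<union> B \<union> C"
      using mid[OF c] mid[OF cycle3_rotate[OF c(1)] c(3,4,2)]
        mid[OF cycle3_rotate[OF cycle3_rotate[OF c(1)]] c(4,2,3)] .
    have e: "(x, y) \<in> \<rho>" "(y, z) \<in> \<rho>" "(z, x) \<in> \<rho>" using c(1) by (simp_all add: cycle3_def)
    have no: "\<not> (x \<in> A \<and> y \<in> A \<and> z \<in> A)" "\<not> (x \<in> B \<and> y \<in> B \<and> z \<in> B)"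
      "\<not> (x \<in> C \<and> y \<in> C \<and> z \<in> C)"
      using cycle_freeD[OF ac(2) c(1)] cycle_freeD[OF ac(3) c(1)] cycle_freeD[OF ac(4) c(1)] by blast+
    have disj: "\<not> (x \<in> A \<and> x \<in> B)" "\<not> (x \<in> B \<and> x \<in> C)" "\<not> (x \<in> C \<and> x \<in> A)"
      using arr(3-5) asym[of x x] by blast+
    show ?thesis
      using m(1) no disj succ[OF e(1) m(2)] succ[OF e(2) m(3)] succ[OF e(3) m(1)]
      unfolding Un_iff mem_Sigma_iff by satx
  qed
  have sup: "cycle3 \<rho> x y z \<and> x \<in> ?Q \<and> y \<in> ?Q \<and> z \<in> ?Q"
    if "(x, y, z) \<in> A \<times> B \<times> C \<union> B \<times> C \<times> A \<union> C \<times> A \<times> B" for x y z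
    using that subsetD[OF arr(3)] subsetD[OF arr(4)] subsetD[OF arr(5)] by (auto simp: cycle3_def)
  show ?thesis
  proof (rule set_eqI)
    fix t :: "'a \<times> 'a \<times> 'a"
    obtain x y z where t: "t = (x, y, z)" by (cases t)
    show "t \<in> cycles3 \<rho> ?Q \<longleftrightarrow> t \<in> A \<times> B \<times> C \<union> B \<times> C \<times> A \<union> C \<times> A \<times> B"
      unfolding t cycles3_def using sub[of x y z] sup[of x y z]
      by (simp only: mem_Collect_eq case_prod_conv) blast
  qed
qed

text \<open>All four claims are read off from the list of 3-cycles. Each of them meets
  \<open>C\<close>, so a one-point \<open>C\<close> excludes two disjoint 3-cycles.\<close>

lemma blown_up_cycle_invariants:
  assumes T: "tournament E \<rho>" and bl: "blown_up_cycle \<rho> W A B C Z"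
    and fin: "finite W" "finite A" "finite B" "finite C" "finite Z"
  shows "card (cycles3 \<rho> (W \<union> A \<union> B \<union> C \<union> Z)) = 3 * (card A * card B * card C)"
    and "A \<noteq> {} \<Longrightarrow> B \<noteq> {} \<Longrightarrow> C \<noteq> {} \<Longrightarrow> cycle_dominators \<rho> (W \<union> A \<union> B \<union> C \<union> Z) = W"
    and "card (W \<union> A \<union> B \<union> C \<union> Z) = card W + card A + card B + card C + card Z"
    and "\<not> packs \<rho> (Suc (card C)) (W \<union> A \<union> B \<union> C \<union> Z)"
proof -
  note asym = tournament_asym[OF T] and cyc = blown_up_cycle_cycles3[OF T bl]
  have arr: "W \<times> (A \<union> B \<union> C \<union> Z) \<subseteq> \<rho>" "(A \<union> B \<union> C) \<times> Z \<subseteq> \<rho>" "A \<times> B \<subseteq> \<rho>" "B \<times> C \<subseteq> \<rho>" "C \<times> A \<subseteq> \<rho>"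
    using bl by (simp_all only: blown_up_cycle_def simp_thms)
  have irr: "(x, x) \<notin> \<rho>" for x using asym[of x x] by blast
  have disj: "A \<inter> B = {}" "B \<inter> C = {}" "C \<inter> A = {}" "W \<inter> (A \<union> B \<union> C \<union> Z) = {}" "(A \<union> B \<union> C) \<inter> Z = {}"
    using arr irr by blast+
  have "card (A \<times> B \<times> C \<union> B \<times> C \<times> A \<union> C \<times> A \<times> B)
      = card (A \<times> B \<times> C) + card (B \<times> C \<times> A) + card (C \<times> A \<times> B)"
    using fin disj(1-3)
    by (subst card_Un_disjoint, simp, simp, blast, subst card_Un_disjoint) auto
  then show "card (cycles3 \<rho> (W \<union> A \<union> B \<union> C \<union> Z)) = 3 * (card A * card B * card C)"
    unfolding cyc by (simp add: card_cartesian_product)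
  have "(A \<union> B) \<inter> C = {}" "W \<inter> (A \<union> B \<union> C) = {}" "(W \<union> (A \<union> B \<union> C)) \<inter> Z = {}"
    using disj by blast+
  then have "card (W \<union> (A \<union> B \<union> C) \<union> Z) = card W + (card A + card B + card C) + card Z"
    using fin disj(1) by (simp only: card_Un_disjoint finite_Un simp_thms)
  then show "card (W \<union> A \<union> B \<union> C \<union> Z) = card W + card A + card B + card C + card Z"
    by (simp add: Un_assoc)
  show "\<not> packs \<rho> (Suc (card C)) (W \<union> A \<union> B \<union> C \<union> Z)"
  proof (rule not_packs_hitting_set[OF fin(4)])
    fix x y z assume "x \<in> W \<union> A \<union> B \<union> C \<union> Z" "y \<in> W \<union> A \<union> B \<union> C \<union> Z" "z \<in> W \<union> A \<union> B \<union> C \<union> Z"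
      "cycle3 \<rho> x y z"
    then have "(x, y, z) \<in> A \<times> B \<times> C \<union> B \<times> C \<times> A \<union> C \<times> A \<times> B"
      unfolding cyc[symmetric] by (simp add: cycles3_def)
    then show "{x, y, z} \<inter> C \<noteq> {}" by blast
  qed
  assume ne: "A \<noteq> {}" "B \<noteq> {}" "C \<noteq> {}"
  show "cycle_dominators \<rho> (W \<union> A \<union> B \<union> C \<union> Z) = W"
  proof (rule equalityI; rule subsetI)
    fix w assume "w \<in> W"
    moreover obtain a b c where "a \<in> A" "b \<in> B" "c \<in> C" using ne by blast
    ultimately show "w \<in> cycle_dominators \<rho> (W \<union> A \<union> B \<union> C \<union> Z)"
      using arr(1) unfolding cycle_dominators_def cyc by blast
  next
    fix w assume "w \<in> cycle_dominators \<rho> (W \<union> A \<union> B \<union> C \<union> Z)"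
    then obtain a b c where "w \<in> W \<union> A \<union> B \<union> C \<union> Z" "a \<in> A" "b \<in> B" "c \<in> C"
      "(w, a) \<in> \<rho>" "(w, b) \<in> \<rho>" "(w, c) \<in> \<rho>"
      unfolding cycle_dominators_def cyc by blast
    then show "w \<in> W"
      using arr(2-5) asym[of w a] asym[of w b] asym[of w c] by blast
  qed
qed

text \<open>Two parts of sizes k and 2 * M - k give this number of 3-cycles. The restriction to k at
  most M avoids the symmetry that exchanges the two sizes.\<close>

lemma inj_on_mult_diff: "inj_on (\<lambda>k. k * (2 * M - k)) {1..M::nat}"
proof (rule strict_mono_on_imp_inj_on, rule strict_mono_onI)
  fix r s assume "r \<in> {1..M}" "s \<in> {1..M}" "r < s"
  then obtain i j where "s = r + Suc i" "M = r + Suc i + j"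
    by (metis add_Suc_right atLeastAtMost_iff le_iff_add less_iff_Suc_add)
  then show "r * (2 * M - r) < s * (2 * M - s)"
    by (simp add: algebra_simps)
qed

lemma inj_on_inner:
  assumes "inj_on g K" "\<And>k. k \<in> K \<Longrightarrow> f k = g k"
  shows "inj_on (\<lambda>k. (f k, h k)) K"
  using assms by (auto simp: inj_on_def)

text \<open>The consequence of finite generation for \<open>m = 1\<close>. Everything in this locale
  serves to deduce that finitely many vertices meet all 3-cycles.\<close>

locale few_blown_up_cycles =
  fixes E :: "'a set" and \<rho> :: "'a rel" and b :: nat
  assumes tournament: "tournament E \<rho>"
    and bound: "\<And>n. card (types_of_size E \<rho> (\<lambda>Q. \<not> packs \<rho> (Suc 1) Q) n) \<le> b"
begin

lemmas asym = tournament_asym[OF tournament] and total = tournament_total[OF tournament]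

lemma irreflexive: "(x, x) \<notin> \<rho>"
  using asym[of x x] by blast

text \<open>Every 3-cycle of a member passes through \<open>c k\<close>, so the bound applies. The
  pair in \<open>inj\<close> consists of the two invariants, up to the factor 3, hence the members
  would realise more than \<open>b\<close> types of size \<open>Suc n\<close>.\<close>

lemma no_large_family:
  assumes K: "b < card K"
    and fam: "\<And>k. k \<in> K \<Longrightarrow> blown_up_cycle \<rho> (W k) (A k) (B k) {c k} (Z k)"
    and sub: "\<And>k. k \<in> K \<Longrightarrow> W k \<union> A k \<union> B k \<union> {c k} \<union> Z k \<subseteq> E"
    and fin: "\<And>k. k \<in> K \<Longrightarrow> finite (W k \<union> A k \<union> B k \<union> Z k)"
    and ne: "\<And>k. k \<in> K \<Longrightarrow> A k \<noteq> {} \<and> B k \<noteq> {}"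
    and size: "\<And>k. k \<in> K \<Longrightarrow> card (W k) + card (A k) + card (B k) + card (Z k) = n"
    and inj: "inj_on (\<lambda>k. (card (A k) * card (B k), card (W k))) K"
  shows False
proof -
  define Q where "Q k = W k \<union> A k \<union> B k \<union> {c k} \<union> Z k" for k
  have Q: "Q k \<subseteq> E" "finite (Q k)" "card (cycles3 \<rho> (Q k)) = 3 * (card (A k) * card (B k))"
    "cycle_dominators \<rho> (Q k) = W k" "card (Q k) = Suc n" "\<not> packs \<rho> (Suc 1) (Q k)" if "k \<in> K" for k
  proof -
    have fin': "finite (W k)" "finite (A k)" "finite (B k)" "finite {c k}" "finite (Z k)"
      using fin[OF that] by simp_all
    note inv = blown_up_cycle_invariants[OF tournament fam[OF that] fin', folded Q_def]
    show "Q k \<subseteq> E" unfolding Q_def by (rule sub[OF that])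
    show "finite (Q k)" unfolding Q_def using fin' by simp
    show "card (cycles3 \<rho> (Q k)) = 3 * (card (A k) * card (B k))" unfolding inv(1) by simp
    show "cycle_dominators \<rho> (Q k) = W k" using inv(2) ne[OF that] by simp
    show "card (Q k) = Suc n" unfolding inv(3) using size[OF that] by simp
    \<comment> \<open>The equation used for rewriting is \<open>card {c k} = 1\<close>.\<close>
    show "\<not> packs \<rho> (Suc 1) (Q k)" using inv(4) unfolding is_singletonI[THEN is_singleton_altdef[THEN iffD1]] .
  qed
  have types: "(\<lambda>k. iso_type E \<rho> (Q k)) ` K \<subseteq> types_of_size E \<rho> (\<lambda>Q. \<not> packs \<rho> (Suc 1) Q) (Suc n)"
    by (rule image_subsetI, rule types_of_sizeI) (rule Q; assumption)+
  have "inj_on (\<lambda>k. iso_type E \<rho> (Q k)) K"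
  proof (rule inj_onI)
    fix k l assume kl: "k \<in> K" "l \<in> K" and eq: "iso_type E \<rho> (Q k) = iso_type E \<rho> (Q l)"
    note same = card_invariants_eq[OF eq Q(1,2)[OF kl(1)] Q(2)[OF kl(2)],
        unfolded Q(3)[OF kl(1)] Q(3)[OF kl(2)] Q(4)[OF kl(1)] Q(4)[OF kl(2)]]
    show "k = l" by (rule inj_onD[OF inj _ kl]) (use same in simp)
  qed
  from card_inj_on_le[OF this types finite_types_of_size] show False
    using bound[of "Suc n"] K by linarith
qed

text \<open>Only indices \<open>i < j\<close> are constrained. The arcs between \<open>x j\<close>
  and \<open>y i\<close> for \<open>i < j\<close> are described by a second pattern, from
  \<open>y\<close> to \<open>x\<close>, and those of equal index come from the 3-cycles
  themselves.\<close>

definition pattern :: "nat \<Rightarrow> (nat \<Rightarrow> 'a) \<Rightarrow> (nat \<Rightarrow> 'a) \<Rightarrow> bool \<Rightarrow> bool" where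
  "pattern N x y p \<longleftrightarrow> (\<forall>i j. i < j \<longrightarrow> j \<le> N \<longrightarrow> ((x i, y j) \<in> \<rho> \<longleftrightarrow> p))"

definition sequence :: "nat \<Rightarrow> (nat \<Rightarrow> 'a) \<Rightarrow> bool" where
  "sequence N x \<longleftrightarrow> inj_on x {..N} \<and> x ` {..N} \<subseteq> E"

definition apart :: "nat \<Rightarrow> (nat \<Rightarrow> 'a) \<Rightarrow> (nat \<Rightarrow> 'a) \<Rightarrow> bool" where
  "apart N x y \<longleftrightarrow> (\<forall>i\<le>N. \<forall>j\<le>N. x i \<noteq> y j)"

lemma patternD: "pattern N x y p \<Longrightarrow> i < j \<Longrightarrow> j \<le> N \<Longrightarrow> (x i, y j) \<in> \<rho> \<longleftrightarrow> p"
  by (simp add: pattern_def)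

lemma pattern_converseD:
  assumes "pattern N x y p" "x i \<noteq> y j" "sequence N x" "sequence N y" "i < j" "j \<le> N"
  shows "(y j, x i) \<in> \<rho> \<longleftrightarrow> \<not> p"
proof -
  have "x i \<in> E" "y j \<in> E" using assms by (auto simp: sequence_def)
  then show ?thesis
    using patternD[OF assms(1,5,6)] total[OF _ _ assms(2)] asym[of "y j" "x i"] by blast
qed

lemma sequence_neq: "sequence N x \<Longrightarrow> i < j \<Longrightarrow> j \<le> N \<Longrightarrow> x i \<noteq> x j"
  unfolding sequence_def inj_on_def by fastforce

section \<open>Segments and reversal of homogeneous sequences\<close>

lemma cycle_free_singleton: "cycle_free \<rho> {x}" "cycle_free \<rho> {}"
  using irreflexive by (auto simp: cycle_free_def cycle3_def)

text \<open>The sequence is linearly ordered by its index or by the reversed index, so the arcs of a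
  3-cycle would give a closed chain of strict inequalities.\<close>

lemma cycle_free_sequence:
  assumes "sequence N x" "pattern N x x p" "I \<subseteq> {..N}"
  shows "cycle_free \<rho> (x ` I)"
proof -
  have edge: "if p then i < j else j < i" if ij: "i \<in> I" "j \<in> I" "(x i, x j) \<in> \<rho>" for i j
  proof -
    have "i \<le> N" "j \<le> N" using ij(1,2) assms(3) by auto
    moreover have "i \<noteq> j" using irreflexive ij(3) by blast
    moreover have "\<not> p" if "j < i" "i \<le> N"
      using pattern_converseD[OF assms(2) _ assms(1,1) that] sequence_neq[OF assms(1) that] ij(3) by blast
    moreover have "p" if "i < j" "j \<le> N" using patternD[OF assms(2) that] ij(3) by blast
    ultimately show ?thesis by (cases i j rule: linorder_cases) auto
  qed
  have "\<not> cycle3 \<rho> (x i) (x j) (x k)" if "i \<in> I" "j \<in> I" "k \<in> I" for i j k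
    using edge[OF that(1,2)] edge[OF that(2,3)] edge[OF that(3,1)]
    by (cases p) (auto simp: cycle3_def)
  then show ?thesis by (auto simp: cycle_free_def)
qed

lemma cycle_free_segments:
  assumes "sequence N x" "pattern N x x p"
  shows "k \<le> Suc N \<Longrightarrow> cycle_free \<rho> (x ` {..<k})" "cycle_free \<rho> (x ` {k<..N})"
    "cycle_free \<rho> (x ` {k..N})"
  by (rule cycle_free_sequence[OF assms]; auto)+

lemma card_below: "sequence N x \<Longrightarrow> k \<le> Suc N \<Longrightarrow> card (x ` {..<k}) = k"
  unfolding sequence_def by (subst card_image) (auto intro: inj_on_subset)

lemma card_above: "sequence N x \<Longrightarrow> card (x ` {k<..N}) = N - k"
  unfolding sequence_def by (subst card_image) (auto intro: inj_on_subset)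

lemma card_from: "sequence N x \<Longrightarrow> card (x ` {k..N}) = Suc N - k"
  unfolding sequence_def by (subst card_image) (auto intro: inj_on_subset)

text \<open>Reversing the indices turns a decreasing sequence into an increasing one and keeps
  elements of equal index together, so a sequence of 3-cycles remains one.\<close>

lemma pattern_rev:
  assumes p: "pattern N x y p" and x: "sequence N x" and y: "sequence N y"
    and ne: "\<And>i j. i < j \<Longrightarrow> j \<le> N \<Longrightarrow> x i \<noteq> y j"
  shows "pattern N (\<lambda>i. y (N - i)) (\<lambda>i. x (N - i)) (\<not> p)"
  unfolding pattern_def
proof (intro allI impI)
  fix i j assume "i < j" "j \<le> N"
  then have ij: "N - j < N - i" "N - i \<le> N" by auto
  show "(y (N - i), x (N - j)) \<in> \<rho> \<longleftrightarrow> \<not> p"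
    by (rule pattern_converseD[OF p ne[OF ij] x y ij])
qed

lemma sequence_rev:
  assumes "sequence N x" shows "sequence N (\<lambda>i. x (N - i))"
proof -
  have "inj_on (x \<circ> (-) N) {..N}"
    using assms unfolding sequence_def
    by (intro comp_inj_on) (auto intro: inj_onI inj_on_subset)
  then show ?thesis using assms by (auto simp: sequence_def o_def)
qed

lemma apart_rev: "apart N x y \<Longrightarrow> apart N (\<lambda>i. x (N - i)) (\<lambda>i. y (N - i))"
  by (simp add: apart_def)

lemma apart_sym: "apart N x y \<Longrightarrow> apart N y x"
  by (simp add: apart_def) metis

lemma apartD: "apart N x y \<Longrightarrow> i \<le> N \<Longrightarrow> j \<le> N \<Longrightarrow> x i \<noteq> y j"
  by (simp add: apart_def)

text \<open>If \<open>p\<close> fails, \<open>y k\<close> dominates every earlier \<open>x i\<close>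
  and can be the one-point part \<open>C\<close>, with \<open>A\<close> the segment of
  \<open>x\<close> before \<open>k\<close>. If \<open>q\<close> holds, \<open>B\<close> is
  \<open>{x k}\<close> and there are k 3-cycles up to rotation; otherwise \<open>B\<close> is the
  segment after \<open>k\<close> and there are k * (N - k).\<close>

lemma successor_pattern:
  assumes N: "N = 2 * M" "b < M" and x: "sequence N x" and y: "sequence N y" and xy: "apart N x y"
    and xx: "pattern N x x True" and p: "pattern N x y p" and q: "pattern N y x q"
    and edge: "\<And>i. i \<le> N \<Longrightarrow> (x i, y i) \<in> \<rho>"
  shows p
proof (rule ccontr)
  assume "\<not> p"
  have ne: "x i \<noteq> y j" "y j \<noteq> x i" if "i \<le> N" "j \<le> N" for i j
    using apartD[OF xy that] by simp_all
  have e1: "(x i, x j) \<in> \<rho>" and e2: "(y j, x i) \<in> \<rho>" if "i < j" "j \<le> N" for i j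
    using patternD[OF xx that] pattern_converseD[OF p ne(1) x y that] that \<open>\<not> p\<close> by auto
  show False
  proof (cases q)
    case True
    have e3: "(y i, x j) \<in> \<rho>" if "i < j" "j \<le> N" for i j
      using patternD[OF q that] True by simp
    show False
    proof (rule no_large_family[of "{1..N}" "\<lambda>_. {}" "\<lambda>k. x ` {..<k}" "\<lambda>k. {x k}" y "\<lambda>k. x ` {k<..N}" "Suc N"])
      fix k assume k: "k \<in> {1..N}"
      show "blown_up_cycle \<rho> {} (x ` {..<k}) {x k} {y k} (x ` {k<..N})"
        using cycle_free_segments[OF x xx] k
        by (intro blown_up_cycleI) (auto simp: cycle_free_singleton edge e1 e2 e3)
      show "{} \<union> x ` {..<k} \<union> {x k} \<union> {y k} \<union> x ` {k<..N} \<subseteq> E"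
        using k x y unfolding sequence_def by auto
      show "card {} + card (x ` {..<k}) + card {x k} + card (x ` {k<..N}) = Suc N"
        using k by (simp add: card_below[OF x] card_above[OF x])
    next
      show "inj_on (\<lambda>k. (card (x ` {..<k}) * card {x k}, card {})) {1..N}"
        by (rule inj_onI) (simp add: card_below[OF x])
    qed (use N in \<open>auto simp: lessThan_empty_iff\<close>)
  next
    case False
    have e3: "(x j, y i) \<in> \<rho>" if "i < j" "j \<le> N" for i j
      using pattern_converseD[OF q ne(2) y x that] that False by simp
    show False
    proof (rule no_large_family[of "{1..M}" "\<lambda>_. {}" "\<lambda>k. x ` {..<k}" "\<lambda>k. x ` {k<..N}" y "\<lambda>_. {}" N])
      fix k assume k: "k \<in> {1..M}"
      show "blown_up_cycle \<rho> {} (x ` {..<k}) (x ` {k<..N}) {y k} {}"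
        using cycle_free_segments[OF x xx] k N
        by (intro blown_up_cycleI) (auto simp: cycle_free_singleton e1 e2 e3)
      show "{} \<union> x ` {..<k} \<union> x ` {k<..N} \<union> {y k} \<union> {} \<subseteq> E"
        using k N x y unfolding sequence_def by auto
      show "card {} + card (x ` {..<k}) + card (x ` {k<..N}) + card {} = N"
        using k N(1) card_below[OF x, of k] card_above[OF x, of k] by simp
    next
      show "inj_on (\<lambda>k. (card (x ` {..<k}) * card (x ` {k<..N}), card {})) {1..M}"
        by (rule inj_on_inner, rule inj_on_mult_diff)
          (simp add: N(1) card_below[OF x, unfolded N(1)] card_above[OF x, unfolded N(1)])
    qed (use N in \<open>auto simp: lessThan_empty_iff\<close>)
  qed
qed

text \<open>The dual of \<open>successor_pattern\<close> under reversal of all arcs and all indices.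
  In the case of \<open>p\<close>, the segment of \<open>x\<close> before \<open>k\<close> becomes
  \<open>W\<close>, in place of the segment \<open>Z\<close> after \<open>k\<close> there.\<close>

lemma predecessor_pattern:
  assumes N: "N = 2 * M" "b < M" and x: "sequence N x" and y: "sequence N y" and xy: "apart N x y"
    and xx: "pattern N x x True" and p: "pattern N x y p" and q: "pattern N y x q"
    and edge: "\<And>i. i \<le> N \<Longrightarrow> (y i, x i) \<in> \<rho>"
  shows q
proof (rule ccontr)
  assume "\<not> q"
  have ne: "x i \<noteq> y j" "y j \<noteq> x i" if "i \<le> N" "j \<le> N" for i j
    using apartD[OF xy that] by simp_all
  have e1: "(x i, x j) \<in> \<rho>" and e2: "(x j, y i) \<in> \<rho>" if "i < j" "j \<le> N" for i j
    using patternD[OF xx that] pattern_converseD[OF q ne(2) y x that] that \<open>\<not> q\<close> by auto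
  show False
  proof (cases p)
    case True
    have e3: "(x i, y j) \<in> \<rho>" if "i < j" "j \<le> N" for i j
      using patternD[OF p that] True by simp
    show False
    proof (rule no_large_family[of "{..<N}" "\<lambda>k. x ` {..<k}" "\<lambda>k. x ` {k<..N}" "\<lambda>k. {y k}" x "\<lambda>_. {}" "Suc N"])
      fix k assume k: "k \<in> {..<N}"
      show "blown_up_cycle \<rho> (x ` {..<k}) (x ` {k<..N}) {y k} {x k} {}"
        using cycle_free_segments[OF x xx] k
        by (intro blown_up_cycleI) (auto simp: cycle_free_singleton edge e1 e2 e3)
      show "x ` {..<k} \<union> x ` {k<..N} \<union> {y k} \<union> {x k} \<union> {} \<subseteq> E"
        using k x y unfolding sequence_def by auto
      show "card (x ` {..<k}) + card (x ` {k<..N}) + card {y k} + card {} = Suc N"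
        using k card_below[OF x, of k] card_above[OF x, of k] by simp
    next
      show "inj_on (\<lambda>k. (card (x ` {k<..N}) * card {y k}, card (x ` {..<k}))) {..<N}"
        by (rule inj_onI) (simp add: card_below[OF x])
    qed (use N in auto)
  next
    case False
    have e3: "(y j, x i) \<in> \<rho>" if "i < j" "j \<le> N" for i j
      using pattern_converseD[OF p ne(1) x y that] that False by simp
    show False
    proof (rule no_large_family[of "{1..M}" "\<lambda>_. {}" "\<lambda>k. x ` {..<k}" "\<lambda>k. x ` {k<..N}" y "\<lambda>_. {}" N])
      fix k assume k: "k \<in> {1..M}"
      show "blown_up_cycle \<rho> {} (x ` {..<k}) (x ` {k<..N}) {y k} {}"
        using cycle_free_segments[OF x xx] k N
        by (intro blown_up_cycleI) (auto simp: cycle_free_singleton e1 e2 e3)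
      show "{} \<union> x ` {..<k} \<union> x ` {k<..N} \<union> {y k} \<union> {} \<subseteq> E"
        using k N x y unfolding sequence_def by auto
      show "card {} + card (x ` {..<k}) + card (x ` {k<..N}) + card {} = N"
        using k N(1) card_below[OF x, of k] card_above[OF x, of k] by simp
    next
      show "inj_on (\<lambda>k. (card (x ` {..<k}) * card (x ` {k<..N}), card {})) {1..M}"
        by (rule inj_on_inner, rule inj_on_mult_diff)
          (simp add: N(1) card_below[OF x, unfolded N(1)] card_above[OF x, unfolded N(1)])
    qed (use N in \<open>auto simp: lessThan_empty_iff\<close>)
  qed
qed

text \<open>
  The relations that are still open lead to four cases, each with a blown-up 3-cycle in which \<open>k\<close>
  varies. When \<open>x\<close>, \<open>y\<close>, \<open>z\<close> dominate each other cyclically, \<open>y\<close> and \<open>z\<close> are joined through the last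
  or the first element of \<open>z\<close>.
\<close>
lemma no_homogeneous_triple_increasing:
  assumes N: "N = 2 * M" "b < M"
    and seq: "sequence N x" "sequence N y" "sequence N z"
    and apart: "apart N x y" "apart N y z" "apart N z x"
    and xx: "pattern N x x True" and yy: "pattern N y y p"
    and xy: "pattern N x y xy" and yx: "pattern N y x yx" and yz: "pattern N y z yz"
    and zy: "pattern N z y zy" and zx: "pattern N z x zx" and xz: "pattern N x z xz"
    and edge: "\<And>i. i \<le> N \<Longrightarrow> (x i, y i) \<in> \<rho>" "\<And>i. i \<le> N \<Longrightarrow> (y i, z i) \<in> \<rho>"
      "\<And>i. i \<le> N \<Longrightarrow> (z i, x i) \<in> \<rho>"
  shows False
proof -
  have xy zx
    using successor_pattern[OF N seq(1,2) apart(1) xx xy yx edge(1)]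
      predecessor_pattern[OF N seq(1,3) apart_sym[OF apart(3)] xx xz zx edge(3)] by blast+
  have inE: "x i \<in> E" "y i \<in> E" "z i \<in> E" if "i \<le> N" for i
    using seq that unfolding sequence_def by auto
  have e: "(x i, x j) \<in> \<rho>" "(x i, y j) \<in> \<rho>" "(z i, x j) \<in> \<rho>" if "i < j" "j \<le> N" for i j
    using patternD[OF xx that] patternD[OF xy that] patternD[OF zx that] \<open>xy\<close> \<open>zx\<close> by simp_all
  have yx': "(y i, x j) \<in> \<rho> \<longleftrightarrow> yx" "(x j, y i) \<in> \<rho> \<longleftrightarrow> \<not> yx" if "i < j" "j \<le> N" for i j
    using patternD[OF yx that] pattern_converseD[OF yx _ seq(2,1) that] apartD[OF apart(1), of j i] that
    by auto
  have xz': "(x i, z j) \<in> \<rho> \<longleftrightarrow> xz" "(z j, x i) \<in> \<rho> \<longleftrightarrow> \<not> xz" if "i < j" "j \<le> N" for i j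
    using patternD[OF xz that] pattern_converseD[OF xz _ seq(1,3) that] apartD[OF apart(3), of j i] that
    by auto
  note free = cycle_free_segments[OF seq(1) xx] and free_y = cycle_free_segments[OF seq(2) yy]
  note card = card_below[OF seq(1)] card_above[OF seq(1)] card_from[OF seq(1)]
    card_below[OF seq(2)] card_above[OF seq(2)]
  \<comment> \<open>The 3-cycle of index \<open>k\<close> is blown up by putting \<open>x k\<close>
    into \<open>A\<close>. The elements of \<open>x\<close> before \<open>k\<close> go to
    \<open>W\<close> if \<open>xz\<close> holds and to \<open>A\<close> otherwise; those after
    \<open>k\<close> go to \<open>Z\<close> if \<open>yx\<close> holds and to \<open>A\<close>
    otherwise. In the fourth case all of \<open>x\<close> would be in \<open>A\<close> and nothing
    would vary with \<open>k\<close>, so a different construction is required.\<close>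
  consider "yx" "xz" | "yx" "\<not> xz" | "\<not> yx" "xz" | "\<not> yx" "\<not> xz" by blast
  then show False
  proof cases
    case 1
    show False
    proof (rule no_large_family[of "{1..N}" "\<lambda>k. x ` {..<k}" "\<lambda>k. {x k}" "\<lambda>k. {y k}" z "\<lambda>k. x ` {k<..N}" "N + 2"])
      fix k assume k: "k \<in> {1..N}"
      show "blown_up_cycle \<rho> (x ` {..<k}) {x k} {y k} {z k} (x ` {k<..N})"
        using free k 1
        by (intro blown_up_cycleI) (auto simp: cycle_free_singleton edge e yx' xz')
      show "x ` {..<k} \<union> {x k} \<union> {y k} \<union> {z k} \<union> x ` {k<..N} \<subseteq> E" using k inE by auto
      show "card (x ` {..<k}) + card {x k} + card {y k} + card (x ` {k<..N}) = N + 2"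
        using k by (simp add: card)
    next
      show "inj_on (\<lambda>k. (card {x k} * card {y k}, card (x ` {..<k}))) {1..N}"
        by (rule inj_onI) (simp add: card)
    qed (use N in auto)
  next
    case 2
    show False
    proof (rule no_large_family[of "{1..N}" "\<lambda>_. {}" "\<lambda>k. x ` {..<Suc k}" "\<lambda>k. {y k}" z "\<lambda>k. x ` {k<..N}" "N + 2"])
      fix k assume k: "k \<in> {1..N}"
      show "blown_up_cycle \<rho> {} (x ` {..<Suc k}) {y k} {z k} (x ` {k<..N})"
        using free k 2
        by (intro blown_up_cycleI) (auto simp: cycle_free_singleton edge e yx' xz' less_Suc_eq simp del: lessThan_Suc)
      show "{} \<union> x ` {..<Suc k} \<union> {y k} \<union> {z k} \<union> x ` {k<..N} \<subseteq> E" using k inE by auto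
      show "card {} + card (x ` {..<Suc k}) + card {y k} + card (x ` {k<..N}) = N + 2"
        using k by (simp add: card del: lessThan_Suc)
    next
      show "inj_on (\<lambda>k. (card (x ` {..<Suc k}) * card {y k}, card {})) {1..N}"
        by (rule inj_onI) (simp add: card del: lessThan_Suc)
    qed (use N in auto)
  next
    case 3
    show False
    proof (rule no_large_family[of "{1..N}" "\<lambda>k. x ` {..<k}" "\<lambda>k. x ` {k..N}" "\<lambda>k. {y k}" z "\<lambda>_. {}" "N + 2"])
      fix k assume k: "k \<in> {1..N}"
      show "blown_up_cycle \<rho> (x ` {..<k}) (x ` {k..N}) {y k} {z k} {}"
        using free k 3
        by (intro blown_up_cycleI) (auto simp: cycle_free_singleton edge e yx' xz' le_less)
      show "x ` {..<k} \<union> x ` {k..N} \<union> {y k} \<union> {z k} \<union> {} \<subseteq> E" using k inE by auto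
      show "card (x ` {..<k}) + card (x ` {k..N}) + card {y k} + card {} = N + 2"
        using k by (simp add: card)
    next
      show "inj_on (\<lambda>k. (card (x ` {k..N}) * card {y k}, card (x ` {..<k}))) {1..N}"
        by (rule inj_onI) (simp add: card)
    qed (use N in auto)
  next
    case 4
    have all: "(x i, y j) \<in> \<rho>" "(z i, x j) \<in> \<rho>" if "i \<le> N" "j \<le> N" for i j
      using that e(2,3)[of i j] yx'(2)[of j i] xz'(2)[of j i] edge(1,3)[of i] 4
      by (cases i j rule: linorder_cases; simp)+
    \<comment> \<open>For decreasing \<open>y\<close> the reversed sequences are used; the pattern
      from reversed \<open>y\<close> to reversed \<open>z\<close> is
      \<open>\<not> zy\<close>.\<close>
    have "if p then yz else \<not> zy"
    proof (cases p)
      case True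
      then show ?thesis
        using successor_pattern[OF N seq(2,3) apart(2) _ yz zy edge(2)] yy by simp
    next
      case False
      have "pattern N (\<lambda>i. y (N - i)) (\<lambda>i. y (N - i)) True"
        using pattern_rev[OF yy seq(2,2) sequence_neq[OF seq(2)]] False by simp
      from successor_pattern[OF N sequence_rev[OF seq(2)] sequence_rev[OF seq(3)] apart_rev[OF apart(2)] this
          pattern_rev[OF zy seq(3,2)] pattern_rev[OF yz seq(2,3)]]
      have "\<not> zy" using apartD[OF apart(2)] apartD[OF apart_sym[OF apart(2)]] edge(2) by simp
      then show ?thesis using False by simp
    qed
    then consider yz | "\<not> zy" by (cases p) auto
    then show False
    proof cases
      case 1
      then have last: "(y i, z N) \<in> \<rho>" if "i \<le> N" for i
        using that patternD[OF yz, of i N] edge(2)[of N] by (cases "i = N") auto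
      show False
      \<comment> \<open>All of \<open>x\<close> dominates all of \<open>y\<close>, so only the sizes
        of the two segments matter; they are chosen to add up to \<open>N\<close>.\<close>
      proof (rule no_large_family[of "{1..M}" "\<lambda>_. {}" "\<lambda>k. x ` {..<k}" "\<lambda>k. y ` {k<..N}" "\<lambda>_. z N" "\<lambda>_. {}" N])
        fix k assume k: "k \<in> {1..M}"
        have "k \<le> N" using k N(1) by simp
        then show "blown_up_cycle \<rho> {} (x ` {..<k}) (y ` {k<..N}) {z N} {}"
          using free free_y
          by (intro blown_up_cycleI) (auto simp: cycle_free_singleton all last)
        show "{} \<union> x ` {..<k} \<union> y ` {k<..N} \<union> {z N} \<union> {} \<subseteq> E" using k N inE by auto
        show "card {} + card (x ` {..<k}) + card (y ` {k<..N}) + card {} = N"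
          using k N(1) card(1)[of k] card(5)[of k] by simp
      next
        show "inj_on (\<lambda>k. (card (x ` {..<k}) * card (y ` {k<..N}), card {})) {1..M}"
          by (rule inj_on_inner, rule inj_on_mult_diff) (simp add: N(1) card[unfolded N(1)])
      qed (use N in \<open>auto simp: lessThan_empty_iff\<close>)
    next
      case 2
      then have first: "(y i, z 0) \<in> \<rho>" if "i \<le> N" for i
        using that pattern_converseD[OF zy _ seq(3,2), of 0 i] apartD[OF apart(2), of i 0] edge(2)[of 0]
        by (cases "i = 0") auto
      show False
      proof (rule no_large_family[of "{1..M}" "\<lambda>_. {}" "\<lambda>k. x ` {k<..N}" "\<lambda>k. y ` {..<k}" "\<lambda>_. z 0" "\<lambda>_. {}" N])
        fix k assume k: "k \<in> {1..M}"
        show "blown_up_cycle \<rho> {} (x ` {k<..N}) (y ` {..<k}) {z 0} {}"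
          using free free_y k N
          by (intro blown_up_cycleI) (auto simp: cycle_free_singleton all first)
        show "{} \<union> x ` {k<..N} \<union> y ` {..<k} \<union> {z 0} \<union> {} \<subseteq> E" using k N inE by auto
        show "card {} + card (x ` {k<..N}) + card (y ` {..<k}) + card {} = N"
          using k N(1) card(2)[of k] card(4)[of k] by simp
      next
        show "inj_on (\<lambda>k. (card (x ` {k<..N}) * card (y ` {..<k}), card {})) {1..M}"
          by (rule inj_on_inner, rule inj_on_mult_diff) (simp add: N(1) card[unfolded N(1)])
      qed (use N in \<open>auto simp: lessThan_empty_iff\<close>)
    qed
  qed
qed

section \<open>Ramsey's theorem and the finite set meeting all 3-cycles\<close>

lemma no_homogeneous_triple:
  fixes v :: "nat \<Rightarrow> nat \<Rightarrow> 'a"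
  assumes N: "N = 2 * M" "b < M"
    and seq: "\<And>r. r < 3 \<Longrightarrow> sequence N (v r)"
    and apart: "\<And>r s. r < 3 \<Longrightarrow> s < 3 \<Longrightarrow> r \<noteq> s \<Longrightarrow> apart N (v r) (v s)"
    and pat: "\<And>r s. r < 3 \<Longrightarrow> s < 3 \<Longrightarrow> pattern N (v r) (v s) (P r s)"
    and cycle: "\<And>i. i \<le> N \<Longrightarrow> cycle3 \<rho> (v 0 i) (v 1 i) (v 2 i)"
  shows False
proof -
  have edge: "(v 0 i, v 1 i) \<in> \<rho>" "(v 1 i, v 2 i) \<in> \<rho>" "(v 2 i, v 0 i) \<in> \<rho>" if "i \<le> N" for i
    using cycle[OF that] by (simp_all add: cycle3_def)
  note tri = no_homogeneous_triple_increasing[OF N]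
  show False
  proof (cases "P 0 0")
    case True
    then have "pattern N (v 0) (v 0) True" using pat[of 0 0] by simp
    then show False
      using tri[OF seq[of 0] seq[of 1] seq[of 2] apart[of 0 1] apart[of 1 2] apart[of 2 0] _ pat[of 1 1]
        pat[of 0 1] pat[of 1 0] pat[of 1 2] pat[of 2 1] pat[of 2 0] pat[of 0 2] edge] by simp
  next
    case False
    \<comment> \<open>Here \<open>v 0\<close> is decreasing. Reversal makes it increasing and
      preserves the 3-cycles, while every pattern changes its direction and its truth value.\<close>
    define w where "w r = (\<lambda>i. v r (N - i))" for r
    have wpat: "pattern N (w s) (w r) (\<not> P r s)" if rs: "r < 3" "s < 3" for r s
      unfolding w_def
    proof (rule pattern_rev[OF pat[OF rs] seq[OF rs(1)] seq[OF rs(2)]])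
      fix i j assume "i < j" "j \<le> N"
      then show "v r i \<noteq> v s j"
        using sequence_neq[OF seq[OF rs(1)]] apartD[OF apart[OF rs], of i j] by (cases "r = s") auto
    qed
    have wseq: "sequence N (w r)" if "r < 3" for r
      unfolding w_def by (rule sequence_rev[OF seq[OF that]])
    have wapart: "apart N (w r) (w s)" if "r < 3" "s < 3" "r \<noteq> s" for r s
      unfolding w_def by (rule apart_rev[OF apart[OF that]])
    have wedge: "(w 0 i, w 1 i) \<in> \<rho>" "(w 1 i, w 2 i) \<in> \<rho>" "(w 2 i, w 0 i) \<in> \<rho>" if "i \<le> N" for i
      unfolding w_def using edge by simp_all
    have "pattern N (w 0) (w 0) True" using wpat[of 0 0] False by simp
    then show False
      using tri[OF wseq[of 0] wseq[of 1] wseq[of 2] wapart[of 0 1] wapart[of 1 2] wapart[of 2 0] _ wpat[of 1 1]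
        wpat[of 1 0] wpat[of 0 1] wpat[of 2 1] wpat[of 1 2] wpat[of 0 2] wpat[of 2 0] wedge] by simp
  qed
qed

lemma no_infinite_packing:
  fixes t :: "nat \<Rightarrow> nat \<Rightarrow> 'a"
  assumes inE: "\<And>n r. t n r \<in> E"
    and cycle: "\<And>n. cycle3 \<rho> (t n 0) (t n 1) (t n 2)"
    and disjoint: "\<And>m n r s. m < n \<Longrightarrow> r < 3 \<Longrightarrow> s < 3 \<Longrightarrow> t m r \<noteq> t n s"
  shows False
proof -
  define pat where "pat m n = {(r, s). r < 3 \<and> s < 3 \<and> (t m r, t n s) \<in> \<rho>}" for m n
  have pat: "pat m n \<in> Pow ({..<3} \<times> {..<3})" for m n by (auto simp: pat_def)
  obtain h :: "(nat \<times> nat) set \<Rightarrow> nat"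
    where h: "bij_betw h (Pow ({..<3} \<times> {..<3})) {0..<card (Pow ({..<3::nat} \<times> {..<3::nat}))}"
    using ex_bij_betw_finite_nat[of "Pow ({..<3} \<times> {..<3})"] by auto
  \<comment> \<open>The colour of a pair of 3-cycles is the set of arcs from the one of smaller
    index to the other, numbered by \<open>h\<close>. \<open>Min\<close> and \<open>Max\<close>
    recover the order of the indices from the unordered pair.\<close>
  define f where "f X = h (pat (Min X) (Max X))" for X
  have "f {i, j} < card (Pow ({..<3::nat} \<times> {..<3::nat}))" for i j
    unfolding f_def using bij_betw_apply[OF h pat] by simp
  then have "\<exists>Y k. Y \<subseteq> UNIV \<and> infinite Y \<and> k < card (Pow ({..<3::nat} \<times> {..<3::nat})) \<and>
      (\<forall>i\<in>Y. \<forall>j\<in>Y. i \<noteq> j \<longrightarrow> f {i, j} = k)"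
    by (intro Ramsey2 infinite_UNIV_nat ballI impI)
  then obtain Y k where Y: "infinite Y" "\<And>i j. i \<in> Y \<Longrightarrow> j \<in> Y \<Longrightarrow> i \<noteq> j \<Longrightarrow> f {i, j} = k"
    by (elim exE conjE) simp
  define e where "e = enumerate Y"
  have mono: "e i < e j" if "i < j" for i j
    using that Y(1) by (simp add: e_def enumerate_mono)
  have const: "pat (e i) (e j) = pat (e 0) (e 1)" if "i < j" for i j
  proof -
    have f: "f {e i, e j} = h (pat (e i) (e j))" if "i < j" for i j
      using mono[OF that] by (simp add: f_def)
    have "f {e i, e j} = k" if "i < j" for i j
    proof (rule Y(2))
      show "e i \<noteq> e j" using mono[OF that] by simp
    qed (simp_all add: e_def enumerate_in_set Y(1))
    from this[OF that] this[of 0 1] have "h (pat (e i) (e j)) = h (pat (e 0) (e 1))"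
      using f[OF that] f[of 0 1] by simp
    then show ?thesis using bij_betw_imp_inj_on[OF h] pat by (simp add: inj_on_eq_iff)
  qed
  have distinct: "t m r \<noteq> t m s" if "r < 3" "s < 3" "r \<noteq> s" for m r s
  proof -
    have "t m 0 \<noteq> t m 1" "t m 1 \<noteq> t m 2" "t m 2 \<noteq> t m 0"
      using cycle[of m] irreflexive[of "t m 0"] irreflexive[of "t m 1"] irreflexive[of "t m 2"]
      by (auto simp: cycle3_def)
    moreover have "r \<in> {0, 1, 2}" "s \<in> {0, 1, 2}" using that by auto
    ultimately show ?thesis using that(3) by auto
  qed
  define v where "v r i = t (e i) r" for r i
  \<comment> \<open>\<open>Suc b\<close> is the least \<open>M\<close> with
    \<open>b < M\<close>.\<close>
  define N where "N = 2 * Suc b"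
  show False
  proof (rule no_homogeneous_triple[OF N_def, of v "\<lambda>r s. (r, s) \<in> pat (e 0) (e 1)"])
    fix r :: nat assume r: "r < 3"
    have "inj (v r)"
      using disjoint[OF mono r r] by (auto simp: v_def intro: linorder_injI)
    then show "sequence N (v r)"
      using inE by (auto simp: sequence_def v_def intro: inj_on_subset)
  next
    fix r s :: nat assume rs: "r < 3" "s < 3" "r \<noteq> s"
    have "v r i \<noteq> v s j" for i j
      using disjoint[OF mono[of i j] rs(1,2)] disjoint[OF mono[of j i] rs(2,1)] distinct[OF rs]
      by (cases i j rule: linorder_cases) (auto simp: v_def)
    then show "apart N (v r) (v s)" by (simp add: apart_def)
  next
    fix r s :: nat assume rs: "r < 3" "s < 3"
    have "(v r i, v s j) \<in> \<rho> \<longleftrightarrow> (r, s) \<in> pat (e i) (e j)" for i j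
      using rs by (simp add: v_def pat_def)
    then show "pattern N (v r) (v s) ((r, s) \<in> pat (e 0) (e 1))"
      unfolding pattern_def by (metis const)
  qed (simp_all add: v_def cycle del: One_nat_def)
qed

lemma finite_cycle_hitting_set:
  "\<exists>U. finite U \<and> (\<forall>x y z. {x, y, z} \<subseteq> E \<longrightarrow> cycle3 \<rho> x y z \<longrightarrow> {x, y, z} \<inter> U \<noteq> {})"
proof (rule ccontr)
  define hits where "hits U \<longleftrightarrow>
      (\<forall>x y z. {x, y, z} \<subseteq> E \<longrightarrow> cycle3 \<rho> x y z \<longrightarrow> {x, y, z} \<inter> U \<noteq> {})" for U
  assume "\<nexists>U. finite U \<and>
    (\<forall>x y z. {x, y, z} \<subseteq> E \<longrightarrow> cycle3 \<rho> x y z \<longrightarrow> {x, y, z} \<inter> U \<noteq> {})"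
  then have none: "\<nexists>U. finite U \<and> hits U" unfolding hits_def .
  have avoid: "\<exists>x y z. {x, y, z} \<subseteq> E - U \<and> cycle3 \<rho> x y z" if "finite U" for U
  proof -
    have "\<not> hits U" using none that by blast
    then obtain x y z where "{x, y, z} \<subseteq> E" "cycle3 \<rho> x y z" "{x, y, z} \<inter> U = {}"
      unfolding hits_def not_all not_imp not_not by (elim exE conjE)
    then show ?thesis by (intro exI[of _ x] exI[of _ y] exI[of _ z]) auto
  qed
  \<comment> \<open>The alternative \<open>infinite (range (g m))\<close> allows the choice step for
    an arbitrary \<open>g\<close>: only finite earlier ranges need to be avoided. It is discarded
    afterwards, since all chosen ranges are finite.\<close>
  define good where "good g n c \<longleftrightarrow> range c \<subseteq> E \<and> cycle3 \<rho> (c 0) (c 1) (c 2) \<and>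
      (\<forall>m<n. range (g m) \<inter> range c = {} \<or> infinite (range (g m)))"
    for g :: "nat \<Rightarrow> nat \<Rightarrow> 'a" and n :: nat and c :: "nat \<Rightarrow> 'a"
  have "\<exists>t. \<forall>n. good t n (t n) \<and> finite (range (t n))"
  proof (rule dependent_wellorder_choice)
    fix n :: nat and g :: "nat \<Rightarrow> nat \<Rightarrow> 'a"
    define U where "U = (\<Union>m\<in>{m. m < n \<and> finite (range (g m))}. range (g m))"
    have "finite U" unfolding U_def by (rule finite_UN_I) auto
    then obtain x y z where xyz: "{x, y, z} \<subseteq> E - U" "cycle3 \<rho> x y z" using avoid by blast
    \<comment> \<open>All indices from 2 on give \<open>z\<close>, so the range of \<open>c\<close>
      is exactly the vertex set of the 3-cycle, and disjoint ranges mean disjoint 3-cycles.\<close>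
    define c where "c r = (if r = 0 then x else if r = 1 then y else z)" for r :: nat
    have "range c \<subseteq> {x, y, z}" by (auto simp: c_def)
    then have "good g n c \<and> finite (range c)"
      using xyz finite_subset[of "range c" "{x, y, z}"] unfolding good_def U_def
      by (auto simp: c_def)
    then show "\<exists>c. good g n c \<and> finite (range c)" by (rule exI[of _ c])
  qed (simp add: good_def)
  then obtain t where t: "\<And>n. good t n (t n)" "\<And>n. finite (range (t n))" by blast
  show False
  proof (rule no_infinite_packing[of t])
    fix m n r s :: nat assume "m < n"
    then have "range (t m) \<inter> range (t n) = {}" using t unfolding good_def by blast
    then show "t m r \<noteq> t n s" by blast
  next
    show "t n r \<in> E" for n r using t(1)[of n] by (auto simp: good_def)
    show "cycle3 \<rho> (t n 0) (t n 1) (t n 2)" for n using t(1)[of n] by (simp only: good_def)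
  qed
qed

end

section \<open>The main theorem\<close>

lemma bounded_profile_if_finitely_generated:
  assumes T: "tournament E \<rho>"
    and fg: "age_algebra_finitely_generated TYPE('k::field_char_0) E \<rho>"
  shows "bounded_profile E \<rho>"
proof -
  obtain b where "\<And>n. card (types_of_size E \<rho> (\<lambda>Q. \<not> packs \<rho> (Suc 1) Q) n) \<le> b"
    using bounded_types_if_finitely_generated[OF T fg, of 1] by metis
  then interpret few_blown_up_cycles E \<rho> b using T by unfold_locales
  obtain U where U: "finite U"
    "\<And>x y z. {x, y, z} \<subseteq> E \<Longrightarrow> cycle3 \<rho> x y z \<Longrightarrow> {x, y, z} \<inter> U \<noteq> {}"
    using finite_cycle_hitting_set by (elim exE conjE) (simp only: simp_thms)
  \<comment> \<open>With \<open>m = card U\<close> the restriction on disjoint 3-cycles excludes no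
    set, so the second use of the bound concerns the profile itself.\<close>
  have "\<not> packs \<rho> (Suc (card U)) Q" if "Q \<subseteq> E" for Q
    by (rule not_packs_hitting_set[OF U(1)], rule U(2)) (use that in auto)
  then have "types_of_size E \<rho> (\<lambda>Q. \<not> packs \<rho> (Suc (card U)) Q) n = types_of_size E \<rho> (\<lambda>_. True) n" for n
    unfolding types_of_size_def by blast
  moreover obtain B where "\<And>n. card (types_of_size E \<rho> (\<lambda>Q. \<not> packs \<rho> (Suc (card U)) Q) n) \<le> B"
    using bounded_types_if_finitely_generated[OF T fg, of "card U"] by metis
  ultimately show ?thesis unfolding bounded_profile_def profile_eq_card_types by auto
qed

theorem mainTheorem7:
  fixes E :: "'a set" and \<rho> :: "'a rel"
  assumes "tournament E \<rho>"
  shows "age_algebra_finitely_generated TYPE('k::field_char_0) E \<rho> \<longleftrightarrow> bounded_profile E \<rho>"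
  using bounded_profile_if_finitely_generated[OF assms] finitely_generated_if_bounded_profile by blast

end
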